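(* Let $\Gamma = \{0,1\}$ and let $Z \subset \Gamma^{\mathbb{Z}}$ be the one-dimensional shift space defined by the following forbidden patterns: $0^m 1 0^m 1$ for all $m > 0$, and $1 0^n 1 1$ and $1 0^n 1 0^{n+2}$ for all $n \geq 0$. Then $Z$ is the orbit closure (under the shift $\mathbb{Z}$-action) of the configuration $z = {}^\infty 0 . 1 1 0 1 0 0 1 0 0 0 1 \cdots$, that is, $z_i = 1$ if $i = n(n+1)/2$ for some integer $n \geq 0$, and $z_i = 0$ otherwise. Moreover, for every $d \geq 2$, the vertically constant shift space $P^\dag(Z) \subset \Gamma^{\mathbb{Z}^d}$ is a sofic shift with countably many configurations, but it is not countably covered. In particular, there exist countable multidimensional sofic shifts that have no SFT cover with countably many configurations.
   Context: For a finite alphabet $\Sigma$ and $d \geq 1$, $\Sigma^{\mathbb{Z}^d}$ carries the product topology and its elements are called configurations; $\mathbb{Z}^d$ acts by $\sigma^{\vec v}(x)_{\vec w} = x_{\vec v + \vec w}$. A shift space is a closed, shift-invariant subset of $\Sigma^{\mathbb{Z}^d}$; equivalently, it is the set of configurations in which no pattern from some set of forbidden finite patterns occurs. It is a shift of finite type (SFT) if the set of forbidden patterns can be chosen finite. A block code is a continuous map between two $\mathbb{Z}^d$-shift spaces that commutes with the shift actions. A sofic shift is the image of an SFT under a block code; the SFT together with the block code is called an SFT cover of its image. A sofic shift is countably covered if it has an SFT cover whose SFT has countably many configurations. A configuration $x \in \Sigma^{\mathbb{Z}^d}$ is vertically constant if $\sigma^{\vec e_i}(x) = x$ for each standard basis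 vector $\vec e_2, \ldots, \vec e_d$; a shift space is vertically constant if all its configurations are. For a one-dimensional shift space $Z \subset \Gamma^{\mathbb{Z}}$, $P^\dag(Z) \subset \Gamma^{\mathbb{Z}^d}$ is the vertically constant shift space consisting of all $x \in \Gamma^{\mathbb{Z}^d}$ for which there is $y \in Z$ with $x_{(n_1, \ldots, n_d)} = y_{n_1}$ for all $(n_1,\ldots,n_d) \in \mathbb{Z}^d$. *)

theory Defs
  imports "HOL-Analysis.Analysis"
begin

text \<open>
  Configurations are functions \<open>'g \<Rightarrow> 'a\<close> on an abelian group \<open>'g\<close>, which is \<open>int\<close> for
  \<open>\<int>\<close> and \<open>int ^ 'd\<close> for \<open>\<int>\<^sup>d\<close> with \<open>d = CARD('d)\<close>. The alphabet is a finite set \<open>A :: 'a set\<close>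
  with the discrete topology.
\<close>

definition config_topology :: "'a set \<Rightarrow> ('g \<Rightarrow> 'a) topology" where
  "config_topology A = product_topology (\<lambda>_. discrete_topology A) UNIV"

definition shift :: "'g::ab_group_add \<Rightarrow> ('g \<Rightarrow> 'a) \<Rightarrow> ('g \<Rightarrow> 'a)" where
  "shift v x = (\<lambda>w. x (v + w))"

definition shift_space :: "'a set \<Rightarrow> ('g::ab_group_add \<Rightarrow> 'a) set \<Rightarrow> bool" where
  "shift_space A X \<longleftrightarrow>
     finite A \<and> closedin (config_topology A) X \<and> (\<forall>v. \<forall>x\<in>X. shift v x \<in> X)"

definition orbit_closure :: "'a set \<Rightarrow> ('g::ab_group_add \<Rightarrow> 'a) \<Rightarrow> ('g \<Rightarrow> 'a) set" where
  "orbit_closure A x = config_topology A closure_of range (\<lambda>v. shift v x)"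

text \<open>A pattern is a partial map; its domain is the shape.\<close>

definition patterns :: "'a set \<Rightarrow> ('g \<rightharpoonup> 'a) set" where
  "patterns A = {p. finite (dom p) \<and> ran p \<subseteq> A}"

definition occurs_in :: "('g::ab_group_add \<rightharpoonup> 'a) \<Rightarrow> ('g \<Rightarrow> 'a) \<Rightarrow> bool" where
  "occurs_in p x \<longleftrightarrow> (\<exists>v. \<forall>w\<in>dom p. p w = Some (shift v x w))"

definition avoiding :: "'a set \<Rightarrow> ('g::ab_group_add \<rightharpoonup> 'a) set \<Rightarrow> ('g \<Rightarrow> 'a) set" where
  "avoiding A F = {x. range x \<subseteq> A \<and> (\<forall>p\<in>F. \<not> occurs_in p x)}"

definition is_sft :: "'a set \<Rightarrow> ('g::ab_group_add \<Rightarrow> 'a) set \<Rightarrow> bool" where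
  "is_sft A X \<longleftrightarrow>
     shift_space A X \<and> (\<exists>F. finite F \<and> F \<subseteq> patterns A \<and> X = avoiding A F)"

definition block_code ::
  "'a set \<Rightarrow> ('g::ab_group_add \<Rightarrow> 'a) set \<Rightarrow> 'b set \<Rightarrow> ('g \<Rightarrow> 'b) set
     \<Rightarrow> (('g \<Rightarrow> 'a) \<Rightarrow> ('g \<Rightarrow> 'b)) \<Rightarrow> bool" where
  "block_code A X B Y \<phi> \<longleftrightarrow>
     shift_space A X \<and> shift_space B Y \<and>
     continuous_map (subtopology (config_topology A) X) (subtopology (config_topology B) Y) \<phi> \<and>
     (\<forall>v. \<forall>x\<in>X. \<phi> (shift v x) = shift v (\<phi> x))"

definition sft_cover ::
  "'a set \<Rightarrow> ('g::ab_group_add \<Rightarrow> 'a) set \<Rightarrow> (('g \<Rightarrow> 'a) \<Rightarrow> ('g \<Rightarrow> 'b))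
     \<Rightarrow> 'b set \<Rightarrow> ('g \<Rightarrow> 'b) set \<Rightarrow> bool" where
  "sft_cover A S \<phi> B X \<longleftrightarrow> is_sft A S \<and> block_code A S B X \<phi> \<and> \<phi> ` S = X"

text \<open>
  HOL cannot quantify over the type of the symbols of a cover, so the alphabet of a cover is taken
  to be a finite set of natural numbers. Nothing is lost: see \<open>soficI\<close> and
  \<open>countably_coveredI\<close> below.
\<close>

definition sofic :: "'b set \<Rightarrow> ('g::ab_group_add \<Rightarrow> 'b) set \<Rightarrow> bool" where
  "sofic B X \<longleftrightarrow> (\<exists>(A :: nat set) S \<phi>. sft_cover A S \<phi> B X)"

definition countably_covered :: "'b set \<Rightarrow> ('g::ab_group_add \<Rightarrow> 'b) set \<Rightarrow> bool" where
  "countably_covered B X \<longleftrightarrow> (\<exists>(A :: nat set) S \<phi>. sft_cover A S \<phi> B X \<and> countable S)"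

text \<open>The index \<open>i\<close> plays the role of the first coordinate of \<open>\<int>\<^sup>d\<close>.\<close>

definition vertically_constant :: "'d::finite \<Rightarrow> (int ^ 'd \<Rightarrow> 'a) \<Rightarrow> bool" where
  "vertically_constant i x \<longleftrightarrow> (\<forall>j. j \<noteq> i \<longrightarrow> shift (axis j 1) x = x)"

definition P_dag :: "'d::finite \<Rightarrow> (int \<Rightarrow> 'a) set \<Rightarrow> (int ^ 'd \<Rightarrow> 'a) set" where
  "P_dag i Z = {x. \<exists>y\<in>Z. \<forall>n. x n = y (n $ i)}"

definition word_pattern :: "'a list \<Rightarrow> (int \<rightharpoonup> 'a)" where
  "word_pattern w = (\<lambda>i. if 0 \<le> i \<and> i < int (length w) then Some (w ! nat i) else None)"

definition \<Gamma> :: "nat set" where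
  "\<Gamma> = {0, 1}"

definition forbidden_words :: "nat list set" where
  "forbidden_words =
     {replicate m 0 @ [1] @ replicate m 0 @ [1] | m. m > 0} \<union>
     {[1] @ replicate n 0 @ [1, 1] | n. n \<ge> 0} \<union>
     {[1] @ replicate n 0 @ [1] @ replicate (n + 2) 0 | n. n \<ge> 0}"

definition Z_shift :: "(int \<Rightarrow> nat) set" where
  "Z_shift = avoiding \<Gamma> (word_pattern ` forbidden_words)"

definition z_config :: "int \<Rightarrow> nat" where
  "z_config i = (if \<exists>n\<ge>0. i = n * (n + 1) div 2 then 1 else 0)"


lemma topspace_config: "topspace (config_topology A) = {x. range x \<subseteq> A}"
  by (auto simp: config_topology_def PiE_def Pi_def)

lemma vertically_constant_P_dag:
  assumes "x \<in> P_dag i Z"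
  shows "vertically_constant i x"
  using assms by (auto simp: P_dag_def vertically_constant_def shift_def axis_def)

lemma shift_shift: "shift u (shift v x) = shift (u + v) x"
  by (simp add: shift_def algebra_simps)

lemma shift_space_avoiding:
  fixes F :: "('g::ab_group_add \<rightharpoonup> 'a) set"
  assumes "finite A" and F: "F \<subseteq> patterns A"
  shows "shift_space A (avoiding A F)"
proof -
  let ?T = "config_topology A :: ('g \<Rightarrow> 'a) topology"
  define U where "U p v = {x \<in> topspace ?T. \<forall>w\<in>dom p. p w = Some (shift v x w)}"
    for p :: "'g \<rightharpoonup> 'a" and v
  have U: "openin ?T (U p v)" if "p \<in> F" for p v
  proof -
    have fin: "finite (dom p)" and sub: "ran p \<subseteq> A" using that F by (auto simp: patterns_def)
    have 1: "openin ?T {x \<in> topspace ?T. x (v + w) \<in> {the (p w)}}" if "w \<in> dom p" for w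
    proof (rule openin_continuous_map_preimage)
      show "continuous_map ?T (discrete_topology A) (\<lambda>x. x (v + w))"
        unfolding config_topology_def by (rule continuous_map_product_projection) simp
      show "openin (discrete_topology A) {the (p w)}"
        using that sub by (auto simp: ran_def)
    qed
    have "U p v = topspace ?T \<inter> (\<Inter>w\<in>dom p. {x \<in> topspace ?T. x (v + w) \<in> {the (p w)}})"
      by (force simp: U_def shift_def)
    also have "openin ?T \<dots>"
    proof (cases "dom p = {}")
      case False
      then show ?thesis using 1 fin by (intro openin_Int openin_INT2) auto
    qed simp
    finally show ?thesis .
  qed
  have eq: "avoiding A F = topspace ?T - (\<Union>p\<in>F. \<Union>v. U p v)"
    unfolding avoiding_def occurs_in_def U_def topspace_config by blast
  have "closedin ?T (avoiding A F)"
    unfolding eq using U by (intro closedin_diff closedin_topspace openin_Union) auto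
  moreover have "shift v x \<in> avoiding A F" if "x \<in> avoiding A F" for v x
    using that unfolding avoiding_def occurs_in_def
    by (auto simp: shift_shift) (auto simp: shift_def)
  ultimately show ?thesis using assms by (auto simp: shift_space_def)
qed

lemma sft_cover_nat:
  fixes S :: "('g::ab_group_add \<Rightarrow> 'a) set"
  assumes cov: "sft_cover A S \<phi> B X"
  obtains A' :: "nat set" and S' \<phi>'
  where "sft_cover A' S' \<phi>' B X" "countable S \<Longrightarrow> countable S'"
proof -
  have finA: "finite A" and SX: "shift_space A S" "shift_space B X" and im: "\<phi> ` S = X"
    and cont: "continuous_map (subtopology (config_topology A) S) (subtopology (config_topology B) X) \<phi>"
    and comm: "\<And>v x. x \<in> S \<Longrightarrow> \<phi> (shift v x) = shift v (\<phi> x)"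
    using cov by (auto simp: sft_cover_def is_sft_def block_code_def shift_space_def)
  obtain F where F: "finite F" "F \<subseteq> patterns A" "S = avoiding A F"
    using cov by (auto simp: sft_cover_def is_sft_def)
  obtain f :: "'a \<Rightarrow> nat" where f: "inj_on f A"
    using finite_imp_inj_to_nat_seg[OF finA] by blast
  define g where "g = the_inv_into A f"
  have gf: "g (f a) = a" if "a \<in> A" for a
    using that f by (simp add: g_def the_inv_into_f_f)
  define A' where "A' = f ` A"
  have gA: "g a \<in> A" "f (g a) = a" if "a \<in> A'" for a
    using that gf by (auto simp: A'_def)
  define F' where "F' = (\<lambda>p. map_option f \<circ> p) ` F"
  define S' where "S' = avoiding A' F'"
  have occ: "occurs_in (map_option f \<circ> p) x \<longleftrightarrow> occurs_in p (g \<circ> x)"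
    if p: "p \<in> F" and x: "range x \<subseteq> A'" for p and x :: "'g \<Rightarrow> nat"
  proof -
    have "map_option f (p w) = Some (x u) \<longleftrightarrow> p w = Some (g (x u))" for w u
    proof (cases "p w")
      case (Some a)
      then have "a \<in> A" using p F(2) by (auto simp: patterns_def ran_def)
      moreover have "x u \<in> A'" using x by auto
      ultimately show ?thesis using Some gf gA by (metis option.inject option.map(2))
    qed simp
    then show ?thesis by (simp add: occurs_in_def shift_def dom_def)
  qed
  have S'_iff: "x \<in> S' \<longleftrightarrow> range x \<subseteq> A' \<and> g \<circ> x \<in> S" for x
  proof -
    have "range (g \<circ> x) \<subseteq> A" if "range x \<subseteq> A'" using that gA by auto
    then show ?thesis by (auto simp: S'_def F(3) avoiding_def F'_def occ)
  qed
  have S_sub: "range x \<subseteq> A" if "x \<in> S" for x using that by (auto simp: F(3) avoiding_def)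
  have gS: "(\<lambda>x. g \<circ> x) ` S' = S"
  proof
    show "S \<subseteq> (\<lambda>x. g \<circ> x) ` S'"
    proof
      fix x assume x: "x \<in> S"
      then have "g \<circ> (f \<circ> x) = x" using S_sub[OF x] gf by (auto simp: fun_eq_iff)
      moreover have "range (f \<circ> x) \<subseteq> A'" using S_sub[OF x] by (auto simp: A'_def)
      ultimately show "x \<in> (\<lambda>x. g \<circ> x) ` S'" using x S'_iff by (metis image_eqI)
    qed
  qed (auto simp: S'_iff)
  have "S' \<subseteq> (\<lambda>x. f \<circ> x) ` S"
  proof
    fix x assume x: "x \<in> S'"
    then have "f \<circ> (g \<circ> x) = x" using gA(2) by (auto simp: fun_eq_iff S'_iff)
    then show "x \<in> (\<lambda>x. f \<circ> x) ` S" using x S'_iff by (metis image_eqI)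
  qed
  then have cnt: "countable S \<Longrightarrow> countable S'" by (meson countable_image countable_subset)
  have F': "F' \<subseteq> patterns A'"
  proof
    fix q assume "q \<in> F'"
    then obtain p where p: "p \<in> F" "q = map_option f \<circ> p" by (auto simp: F'_def)
    then have "finite (dom p)" "ran p \<subseteq> A" using F by (auto simp: patterns_def)
    moreover have "dom q = dom p" by (auto simp: p(2) dom_def)
    ultimately show "q \<in> patterns A'" by (auto simp: patterns_def p(2) ran_def A'_def)
  qed
  have finA': "finite A'" using finA by (simp add: A'_def)
  have ss: "shift_space A' S'" unfolding S'_def by (rule shift_space_avoiding[OF finA' F'])
  have sft: "is_sft A' S'"
    using ss F' F(1) by (auto simp: is_sft_def S'_def F'_def)
  have "continuous_map (config_topology A') (config_topology A) (\<lambda>x :: 'g \<Rightarrow> nat. g \<circ> x)"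
  proof -
    have "continuous_map (config_topology A') (discrete_topology A) (\<lambda>x :: 'g \<Rightarrow> nat. g (x k))" for k
    proof -
      have "continuous_map (config_topology A') (discrete_topology A') (\<lambda>x :: 'g \<Rightarrow> nat. x k)"
        unfolding config_topology_def by (rule continuous_map_product_projection) simp
      moreover have "continuous_map (discrete_topology A') (discrete_topology A) g"
        using gA by auto
      ultimately show ?thesis
        using continuous_map_compose[of _ _ "\<lambda>x. x k" _ g] by (simp add: o_def)
    qed
    then show ?thesis
      unfolding config_topology_def[of A] by (simp add: continuous_map_componentwise_UNIV o_def)
  qed
  then have "continuous_map (subtopology (config_topology A') S') (subtopology (config_topology A) S)
      (\<lambda>x. g \<circ> x)"
    using gS by (auto simp: continuous_map_in_subtopology intro: continuous_map_from_subtopology)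
  then have "continuous_map (subtopology (config_topology A') S') (subtopology (config_topology B) X)
      (\<lambda>x. \<phi> (g \<circ> x))"
    using continuous_map_compose[OF _ cont] by (simp add: o_def)
  moreover have "\<phi> (g \<circ> shift v x) = shift v (\<phi> (g \<circ> x))" if "x \<in> S'" for v x
    using comm[of "g \<circ> x" v] that S'_iff by (simp add: shift_def o_def)
  moreover have "(\<lambda>x. \<phi> (g \<circ> x)) ` S' = X" using gS im by (metis image_image)
  ultimately have "sft_cover A' S' (\<lambda>x. \<phi> (g \<circ> x)) B X"
    using sft ss SX by (simp add: sft_cover_def block_code_def)
  then show thesis using that cnt by blast
qed

lemma soficI: "sft_cover A S \<phi> B X \<Longrightarrow> sofic B X"
  by (metis sft_cover_nat sofic_def)

lemma countably_coveredI: "sft_cover A S \<phi> B X \<Longrightarrow> countable S \<Longrightarrow> countably_covered B X"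
  by (metis sft_cover_nat countably_covered_def)

end

theory Submission
  imports Defs
begin

text \<open>
  The shift \<open>Z\<close> consists of the shifts of \<open>z\<close>, the configurations with a single \<open>1\<close>, and \<open>0\<close>: in
  a configuration of \<open>Z\<close>, the gap between two consecutive \<open>1\<close>s determines the whole configuration,
  because after a gap of \<open>n\<close> zeros the next gap can only have \<open>n + 1\<close> zeros, and before a gap of
  \<open>n > 0\<close> zeros there must be one with \<open>n - 1\<close> zeros, down to an occurrence of \<open>11\<close>
  (\<open>Z_shift_cases\<close>). Hence \<open>Z\<close> is countable and is the orbit closure of \<open>z\<close>.

  \<^bold>\<open>Soficity.\<close> Choose a second coordinate \<open>j \<noteq> i\<close>, to be thought of as time. The cover keeps the \<open>0\<close>s
  and \<open>1\<close>s as colors, constant in all directions other than \<open>i\<close>, and adds two layers. Layer \<open>A\<close> cuts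
  every row into the blocks \<open>1 0\<^sup>n\<close> that begin at a \<open>1\<close> and end before the next one; layer \<open>B\<close> uses
  only the zeros \<open>0\<^sup>n\<close> of such a block. In each layer the cells of a block read
  \<open>Before \<dots> Before At After \<dots> After\<close>, and as a block may not start with \<open>After\<close> nor end with \<open>Before\<close>,
  a finite nonempty block contains exactly one \<open>At\<close> in every row. This \<open>At\<close> moves one step to the right per time step. It therefore visits each end
  of the block periodically, the period being the number of cells of the block (\<open>run_recurs\<close>). Layer
  \<open>A\<close> to the left of a \<open>1\<close> and layer \<open>B\<close> to its right are synchronized at that \<open>1\<close>. Thus a block \<open>1 0\<^sup>n\<close>
  with \<open>n + 1\<close> cells has to be followed by a gap of \<open>n + 1\<close> zeros. The phase of each synchronized pair
  of layers can be chosen freely, so \<open>z\<close> alone has uncountably many preimages.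

  \<^bold>\<open>No countable cover.\<close> Let \<open>S\<close> be a countable SFT covering the lift of \<open>Z\<close>. The fiber over the lift of
  \<open>z\<close> is a countable compact set on which the translations orthogonal to \<open>e\<^sub>i\<close> act. A minimal closed
  invariant subset is countable, so it has an isolated point, and by minimality and compactness it
  is finite (\<open>finite_invariant_subset\<close>). A point \<open>x\<close> of it thus has only finitely many translates
  orthogonal to \<open>e\<^sub>i\<close>, so \<open>x\<close> is essentially one-dimensional, and a vertical slab of fixed thickness
  has only finitely many possible contents. Around two different \<open>1\<close>s of \<open>z\<close> the slabs agree, and
  gluing the left part of \<open>x\<close> at the first \<open>1\<close> to the right part of \<open>x\<close> at the second yields a point of
  \<open>S\<close> whose image skips some of the gaps. This image is not in the lift of \<open>Z\<close>.
\<close>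

section \<open>Cylinder sets, shifts of finite type and block codes\<close>

definition agree_on :: "'g set \<Rightarrow> ('g \<Rightarrow> 'a) \<Rightarrow> ('g \<Rightarrow> 'a) \<Rightarrow> bool" where
  "agree_on W x y \<longleftrightarrow> (\<forall>w\<in>W. x w = y w)"

lemma openin_config_iff:
  "openin (config_topology A) U \<longleftrightarrow>
     (\<forall>x\<in>U. range x \<subseteq> A \<and> (\<exists>W. finite W \<and> {y. range y \<subseteq> A \<and> agree_on W x y} \<subseteq> U))"
    (is "?L \<longleftrightarrow> ?R")
proof
  assume L: ?L
  show ?R
  proof
    fix x assume x: "x \<in> U"
    then obtain V where V: "finite {i. V i \<noteq> A}" "x \<in> Pi\<^sub>E UNIV V" "Pi\<^sub>E UNIV V \<subseteq> U"
      using L unfolding config_topology_def openin_product_topology_alt by auto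
    have "range x \<subseteq> A"
      using openin_subset[OF L] x by (auto simp: topspace_config)
    moreover have "y \<in> Pi\<^sub>E UNIV V" if y: "range y \<subseteq> A" "agree_on {i. V i \<noteq> A} x y" for y
    proof -
      have "y i \<in> V i" for i
      proof (cases "V i = A")
        case False
        then have "x i = y i" using y(2) by (simp add: agree_on_def)
        moreover have "x i \<in> V i" using V(2) by (rule PiE_mem) simp
        ultimately show ?thesis by simp
      qed (use y(1) in auto)
      then show ?thesis by auto
    qed
    ultimately show "range x \<subseteq> A \<and> (\<exists>W. finite W \<and> {y. range y \<subseteq> A \<and> agree_on W x y} \<subseteq> U)"
      using V(1) subsetD[OF V(3)] by (intro conjI exI[of _ "{i. V i \<noteq> A}"]) auto
  qed
next
  assume R: ?R
  show ?L
    unfolding config_topology_def openin_product_topology_alt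
  proof
    fix x assume x: "x \<in> U"
    obtain W where xA: "range x \<subseteq> A"
      and W: "finite W" "{y. range y \<subseteq> A \<and> agree_on W x y} \<subseteq> U"
      using bspec[OF R x] by (elim conjE exE)
    define V where "V i = (if i \<in> W then {x i} else A)" for i
    have "{i \<in> UNIV. V i \<noteq> topspace (discrete_topology A)} \<subseteq> W" by (auto simp: V_def)
    then have "finite {i \<in> UNIV. V i \<noteq> topspace (discrete_topology A)}"
      using W(1) finite_subset by blast
    moreover have "Pi\<^sub>E UNIV V \<subseteq> {y. range y \<subseteq> A \<and> agree_on W x y}"
    proof
      fix y assume "y \<in> Pi\<^sub>E UNIV V"
      then have y: "y i \<in> V i" for i by auto
      have "y i \<in> A" for i using y[of i] xA by (auto simp: V_def split: if_splits)
      moreover have "x i = y i" if "i \<in> W" for i using y[of i] that by (simp add: V_def)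
      ultimately show "y \<in> {y. range y \<subseteq> A \<and> agree_on W x y}" by (auto simp: agree_on_def)
    qed
    moreover have "x \<in> Pi\<^sub>E UNIV V" "\<forall>i. openin (discrete_topology A) (V i)"
      using xA by (auto simp: V_def)
    ultimately show "\<exists>U'. finite {i \<in> UNIV. U' i \<noteq> topspace (discrete_topology A)} \<and>
        (\<forall>i\<in>UNIV. openin (discrete_topology A) (U' i)) \<and> x \<in> Pi\<^sub>E UNIV U' \<and> Pi\<^sub>E UNIV U' \<subseteq> U"
      using W(2) by (intro exI[of _ V]) auto
  qed
qed

lemma openin_cylinder:
  "openin (config_topology A) {y. range y \<subseteq> A \<and> agree_on W x y}" if "finite W"
  unfolding openin_config_iff using that by (fastforce simp: agree_on_def)

lemma in_closure_of_config_iff: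
  fixes x :: "'g \<Rightarrow> 'a"
  shows "x \<in> config_topology A closure_of R \<longleftrightarrow>
     range x \<subseteq> A \<and> (\<forall>W. finite W \<longrightarrow> (\<exists>y\<in>R. range y \<subseteq> A \<and> agree_on W x y))"
proof -
  have "(\<forall>T. x \<in> T \<and> openin (config_topology A) T \<longrightarrow> (\<exists>y. y \<in> R \<and> y \<in> T)) \<longleftrightarrow>
      (\<forall>W. finite W \<longrightarrow> (\<exists>y\<in>R. range y \<subseteq> A \<and> agree_on W x y))" (is "?L \<longleftrightarrow> ?R")
    if xA: "range x \<subseteq> A"
  proof
    assume L: ?L
    show ?R
    proof (intro allI impI)
      fix W :: "'g set" assume "finite W"
      then show "\<exists>y\<in>R. range y \<subseteq> A \<and> agree_on W x y"
        using L[rule_format, of "{y. range y \<subseteq> A \<and> agree_on W x y}"] openin_cylinder[of W A x] xA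
        by (auto simp: agree_on_def)
    qed
  next
    assume R: ?R
    show ?L
    proof (intro allI impI, elim conjE)
      fix T assume xT: "x \<in> T" and "openin (config_topology A) T"
      then obtain W where "finite W" and W: "{y. range y \<subseteq> A \<and> agree_on W x y} \<subseteq> T"
        unfolding openin_config_iff by (elim ballE[of _ _ x] conjE exE) simp_all
      then obtain y where "y \<in> R" "range y \<subseteq> A \<and> agree_on W x y" using R by (elim allE impE bexE)
      then show "\<exists>y. y \<in> R \<and> y \<in> T" using subsetD[OF W, of y] by auto
    qed
  qed
  then show ?thesis unfolding in_closure_of topspace_config mem_Collect_eq by (rule conj_cong[OF refl])
qed

lemma compact_space_config: "finite A \<Longrightarrow> compact_space (config_topology A)"
  by (auto simp: config_topology_def compact_space_product_topology compact_space_discrete_topology)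

lemma Hausdorff_space_config: "Hausdorff_space (config_topology A)"
  by (auto simp: config_topology_def Hausdorff_space_product_topology)

lemma range_shift: "range x \<subseteq> A \<Longrightarrow> range (shift v x) \<subseteq> A"
  by (auto simp: shift_def)

lemma continuous_map_shift: "continuous_map (config_topology A) (config_topology A) (shift v)"
  by (force simp: config_topology_def continuous_map_componentwise_UNIV shift_def
      intro: continuous_map_product_projection)

lemma continuous_map_letter:
  assumes "f ` A \<subseteq> B"
  shows "continuous_map (config_topology A) (config_topology B) (\<lambda>x :: 'g \<Rightarrow> 'a. f \<circ> x)"
proof -
  have "continuous_map (config_topology A) (discrete_topology B) (\<lambda>x :: 'g \<Rightarrow> 'a. f (x k))" for k
  proof -
    have "continuous_map (config_topology A) (discrete_topology A) (\<lambda>x :: 'g \<Rightarrow> 'a. x k)"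
      unfolding config_topology_def by (rule continuous_map_product_projection) simp
    moreover have "continuous_map (discrete_topology A) (discrete_topology B) f"
      using assms by auto
    ultimately show ?thesis
      using continuous_map_compose[of _ _ "\<lambda>x. x k" _ f] by (simp add: o_def)
  qed
  then show ?thesis
    unfolding config_topology_def[of B] by (simp add: continuous_map_componentwise_UNIV o_def)
qed

text \<open>
  A rule that inspects only a finite window is the same thing as a finite list of forbidden patterns:
  the patterns on the window that violate it.
\<close>

lemma is_sft_local:
  fixes Q :: "('g::ab_group_add \<Rightarrow> 'a) \<Rightarrow> bool"
  assumes A: "finite A" and W: "finite W"
    and Q: "\<And>x y. agree_on W x y \<Longrightarrow> Q x \<longleftrightarrow> Q y"
  shows "is_sft A {x. range x \<subseteq> A \<and> (\<forall>v. Q (shift v x))}"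
proof -
  define F where "F = {p. dom p = W \<and> ran p \<subseteq> A \<and> \<not> Q (the \<circ> p)}"
  have "finite F"
    by (rule finite_subset[OF _ finite_set_of_finite_maps[OF W A]]) (auto simp: F_def)
  have sub: "F \<subseteq> patterns A" using W by (auto simp: F_def patterns_def)
  have "(\<exists>p\<in>F. occurs_in p x) \<longleftrightarrow> (\<exists>v. \<not> Q (shift v x))" if x: "range x \<subseteq> A" for x
  proof
    assume "\<exists>p\<in>F. occurs_in p x"
    then obtain p v where p: "p \<in> F" "\<forall>w\<in>dom p. p w = Some (shift v x w)"
      unfolding occurs_in_def by blast
    then have "agree_on W (the \<circ> p) (shift v x)" by (auto simp: F_def agree_on_def)
    then show "\<exists>v. \<not> Q (shift v x)" using Q p(1) by (auto simp: F_def)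
  next
    assume "\<exists>v. \<not> Q (shift v x)"
    then obtain v where v: "\<not> Q (shift v x)" by blast
    define p where "p w = (if w \<in> W then Some (shift v x w) else None)" for w
    have dom: "dom p = W" by (auto simp: p_def split: if_splits)
    have "agree_on W (the \<circ> p) (shift v x)" by (simp add: agree_on_def p_def)
    moreover have "ran p \<subseteq> A" using range_shift[OF x, of v] by (auto simp: ran_def p_def split: if_splits)
    ultimately have "p \<in> F" using Q v dom by (auto simp: F_def)
    moreover have "occurs_in p x"
      unfolding occurs_in_def dom by (rule exI[of _ v]) (simp add: p_def)
    ultimately show "\<exists>p\<in>F. occurs_in p x" by blast
  qed
  then have eq: "{x. range x \<subseteq> A \<and> (\<forall>v. Q (shift v x))} = avoiding A F"
    unfolding avoiding_def by blast
  show ?thesis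
    unfolding eq is_sft_def using shift_space_avoiding[OF A sub] \<open>finite F\<close> sub by blast
qed

lemma orbit_closure_minimal:
  assumes X: "shift_space A X" and z: "z \<in> X"
  shows "orbit_closure A z \<subseteq> X"
  unfolding orbit_closure_def
  using X z by (intro closure_of_minimal) (auto simp: shift_space_def)

text \<open>
  The Curtis--Hedlund--Lyndon theorem. By continuity, every \<open>x\<close> has a finite window that determines the
  symbol at \<open>v\<close> among the configurations that agree with \<open>x\<close> there; compactness makes the window uniform.
\<close>

lemma block_code_window:
  assumes bc: "block_code A S B Y \<phi>"
  obtains W where "finite W"
    "\<And>x y. x \<in> S \<Longrightarrow> y \<in> S \<Longrightarrow> agree_on W x y \<Longrightarrow> \<phi> x v = \<phi> y v"
proof -
  have A: "finite A" and clS: "closedin (config_topology A) S"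
    and cont: "continuous_map (subtopology (config_topology A) S) (subtopology (config_topology B) Y) \<phi>"
    using bc by (auto simp: block_code_def shift_space_def)
  have SA: "range x \<subseteq> A" if "x \<in> S" for x
    using closedin_subset[OF clS] that by (auto simp: topspace_config)
  have contB: "continuous_map (subtopology (config_topology A) S) (config_topology B) \<phi>"
    using cont continuous_map_into_fulltopology by blast
  have "\<exists>W. finite W \<and> (\<forall>y\<in>S. agree_on W x y \<longrightarrow> \<phi> y v = \<phi> x v)" if x: "x \<in> S" for x
  proof -
    let ?U = "{y. range y \<subseteq> B \<and> agree_on {v} (\<phi> x) y}"
    have "openin (subtopology (config_topology A) S) {y \<in> topspace (subtopology (config_topology A) S). \<phi> y \<in> ?U}"
      by (rule openin_continuous_map_preimage[OF contB openin_cylinder]) simp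
    then obtain T where T: "openin (config_topology A) T"
      "{y \<in> topspace (subtopology (config_topology A) S). \<phi> y \<in> ?U} = T \<inter> S"
      unfolding openin_subtopology by blast
    have "\<phi> x \<in> topspace (config_topology B)"
      using continuous_map_funspace[OF contB] x SA by (auto simp: topspace_config)
    then have "x \<in> T" using T(2) x SA[OF x] by (auto simp: agree_on_def topspace_config)
    then obtain W where W: "finite W" "{y. range y \<subseteq> A \<and> agree_on W x y} \<subseteq> T"
      using T(1) unfolding openin_config_iff by (elim ballE[of _ _ x] conjE exE) simp_all
    have "\<phi> y v = \<phi> x v" if "y \<in> S" "agree_on W x y" for y
    proof -
      have "y \<in> T \<inter> S" using W(2) that SA by blast
      then show ?thesis unfolding T(2)[symmetric] by (simp add: agree_on_def)
    qed
    then show ?thesis using W(1) by blast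
  qed
  then obtain w where w: "\<And>x. x \<in> S \<Longrightarrow> finite (w x)"
    "\<And>x y. x \<in> S \<Longrightarrow> y \<in> S \<Longrightarrow> agree_on (w x) x y \<Longrightarrow> \<phi> y v = \<phi> x v"
    by metis
  let ?C = "\<lambda>x. {y. range y \<subseteq> A \<and> agree_on (w x) x y}"
  have "compactin (config_topology A) S"
    by (rule closedin_compact_space[OF compact_space_config[OF A] clS])
  moreover have "S \<subseteq> \<Union>(?C ` S)" using SA by (auto simp: agree_on_def)
  moreover have "openin (config_topology A) U" if "U \<in> ?C ` S" for U
    using that openin_cylinder w(1) by auto
  ultimately have "\<exists>\<F>. finite \<F> \<and> \<F> \<subseteq> ?C ` S \<and> S \<subseteq> \<Union>\<F>"
    by (intro compactinD)
  then obtain \<F> where \<F>: "finite \<F>" "\<F> \<subseteq> ?C ` S" "S \<subseteq> \<Union>\<F>"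
    by (elim exE conjE)
  then obtain K where K: "finite K" "K \<subseteq> S" "\<F> = ?C ` K"
    using finite_subset_image[OF \<F>(1,2)] by (elim exE conjE)
  show ?thesis
  proof (rule that[of "\<Union>(w ` K)"])
    show "finite (\<Union>(w ` K))" using K w(1) by blast
    fix x y assume xy: "x \<in> S" "y \<in> S" "agree_on (\<Union>(w ` K)) x y"
    obtain k where k: "k \<in> K" "agree_on (w k) k x" using xy(1) \<F>(3) K(3) by blast
    then have "agree_on (w k) k y" using xy(3) by (auto simp: agree_on_def)
    then show "\<phi> x v = \<phi> y v" using w(2)[of k] k K(2) xy by (metis subsetD)
  qed
qed

text \<open>
  A minimal nonempty closed invariant subset \<open>M\<close> exists by compactness and Zorn's lemma. A countable
  compact Hausdorff space is not perfect, so \<open>M\<close> has an isolated point \<open>x\<close>. All orbits in \<open>M\<close> are dense by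
  minimality, so all of them pass through \<open>x\<close>; by compactness, finitely many translations are enough
  to bring every point of \<open>M\<close> to \<open>x\<close>.
\<close>

lemma finite_invariant_subset:
  fixes Y :: "('g::ab_group_add \<Rightarrow> 'a) set"
  assumes A: "finite A" and clY: "closedin (config_topology A) Y" and ne: "Y \<noteq> {}"
    and cY: "countable Y" and inv: "\<And>v x. v \<in> V \<Longrightarrow> x \<in> Y \<Longrightarrow> shift v x \<in> Y"
    and V0: "0 \<in> V" and Vadd: "\<And>u v. u \<in> V \<Longrightarrow> v \<in> V \<Longrightarrow> u + v \<in> V"
    and Vneg: "\<And>u. u \<in> V \<Longrightarrow> - u \<in> V"
  obtains M where "finite M" "M \<noteq> {}" "M \<subseteq> Y" "\<And>v x. v \<in> V \<Longrightarrow> x \<in> M \<Longrightarrow> shift v x \<in> M"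
proof -
  let ?T = "config_topology A :: ('g \<Rightarrow> 'a) topology"
  define \<A> where "\<A> = {M. closedin ?T M \<and> M \<noteq> {} \<and> M \<subseteq> Y \<and> (\<forall>v\<in>V. \<forall>x\<in>M. shift v x \<in> M)}"
  have YA: "Y \<in> \<A>" using clY ne inv by (auto simp: \<A>_def)
  \<comment> \<open>Zorn's lemma is about maximal sets, hence the passage to complements.\<close>
  have "\<exists>M\<in>uminus ` \<A>. \<forall>X\<in>uminus ` \<A>. M \<subseteq> X \<longrightarrow> X = M"
  proof (rule subset_Zorn_nonempty)
    show "uminus ` \<A> \<noteq> {}" using YA by blast
    fix \<C> assume C: "\<C> \<noteq> {}" "subset.chain (uminus ` \<A>) \<C>"
    define \<D> where "\<D> = uminus ` \<C>"
    have D: "\<D> \<subseteq> \<A>" "\<D> \<noteq> {}" "\<Union>\<C> = - \<Inter>\<D>" "\<And>X Z. X \<in> \<D> \<Longrightarrow> Z \<in> \<D> \<Longrightarrow> X \<subseteq> Z \<or> Z \<subseteq> X"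
      using C by (auto simp: subset_chain_def \<D>_def)
    have chain: "\<Inter>\<F> \<in> \<F>" if "finite \<F>" "\<F> \<noteq> {}" "\<F> \<subseteq> \<D>" for \<F>
      using that
    proof (induction rule: finite_ne_induct)
      case (insert X \<F>)
      then have "\<Inter>\<F> \<in> \<D>" "X \<in> \<D>" by auto
      then have "X \<inter> \<Inter>\<F> = X \<or> X \<inter> \<Inter>\<F> = \<Inter>\<F>" using D(4) by blast
      then show ?case using insert by auto
    qed auto
    have "\<Inter>\<D> \<noteq> {}"
    proof (rule compact_space_fip[THEN iffD1, OF compact_space_config[OF A], rule_format], intro conjI allI impI ballI)
      show "closedin ?T X" if "X \<in> \<D>" for X using that D(1) by (auto simp: \<A>_def)
      show "\<Inter>\<F> \<noteq> {}" if "finite \<F> \<and> \<F> \<subseteq> \<D>" for \<F>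
      proof (cases "\<F> = {}")
        case False
        then have "\<Inter>\<F> \<in> \<A>" using chain[of \<F>] that D(1) by blast
        then show ?thesis by (auto simp: \<A>_def)
      qed auto
    qed
    moreover have "closedin ?T (\<Inter>\<D>)" using D(1,2) by (intro closedin_Inter) (auto simp: \<A>_def)
    ultimately have "\<Inter>\<D> \<in> \<A>" using D(1,2) unfolding \<A>_def by blast
    then show "\<Union>\<C> \<in> uminus ` \<A>" using D(3) by blast
  qed
  then obtain M where M: "M \<in> \<A>" and minM: "\<And>X. X \<in> \<A> \<Longrightarrow> X \<subseteq> M \<Longrightarrow> X = M"
    by (metis (no_types, lifting) Compl_subset_Compl_iff double_complement imageE image_eqI)
  have clM: "closedin ?T M" and Mne: "M \<noteq> {}" and MY: "M \<subseteq> Y"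
    and Minv: "\<And>v x. v \<in> V \<Longrightarrow> x \<in> M \<Longrightarrow> shift v x \<in> M"
    using M by (auto simp: \<A>_def)
  have Mtop: "M \<subseteq> topspace ?T" using clM closedin_subset by blast
  have "?T derived_set_of M \<noteq> M"
  proof
    assume "?T derived_set_of M = M"
    then have "(UNIV::real set) \<lesssim> M"
      using lepoll_perfect_set Mne compact_imp_locally_compact_space[OF compact_space_config[OF A]]
        Hausdorff_space_config by blast
    moreover have "countable M" using MY cY countable_subset by blast
    ultimately show False
      using uncountable_UNIV_real countable_lepoll by blast
  qed
  moreover have "?T derived_set_of M \<subseteq> M" using clM by (simp add: closedin_contains_derived_set)
  ultimately have "\<not> M \<subseteq> ?T derived_set_of M" by (metis subset_antisym)
  then obtain x where x: "x \<in> M" "x \<notin> ?T derived_set_of M" by (meson subsetI)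
  have "x \<in> topspace ?T" using Mtop x(1) by (rule subsetD)
  then have "\<exists>U. x \<in> U \<and> openin ?T U \<and> (\<forall>y. y \<noteq> x \<longrightarrow> y \<in> M \<longrightarrow> y \<notin> U)"
    using x(2) unfolding in_derived_set_of de_Morgan_conj not_all not_imp not_ex by (elim disjE exE) auto
  then obtain U where U: "x \<in> U" "openin ?T U" and "\<forall>y. y \<noteq> x \<longrightarrow> y \<in> M \<longrightarrow> y \<notin> U"
    by (elim exE conjE)
  then have Ux: "\<And>y. y \<in> M \<Longrightarrow> y \<in> U \<Longrightarrow> y = x"
    by auto
  have hit: "\<exists>v\<in>V. shift v y \<in> U" if y: "y \<in> M" for y
  proof -
    let ?O = "(\<lambda>v. shift v y) ` V"
    let ?K = "?T closure_of ?O"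
    have O: "?O \<subseteq> M" using Minv y by blast
    then have KM: "?K \<subseteq> M" using clM closure_of_minimal by blast
    have OK: "?O \<subseteq> ?K" using O Mtop by (intro closure_of_subset) blast
    have "shift u k \<in> ?K" if u: "u \<in> V" and k: "k \<in> ?K" for u k
    proof -
      have "shift u ` ?K \<subseteq> ?T closure_of (shift u ` ?O)"
        using continuous_map_image_closure_subset[OF continuous_map_shift] .
      also have "\<dots> \<subseteq> ?K" using u Vadd by (intro closure_of_mono) (auto simp: shift_shift)
      finally show ?thesis using k by blast
    qed
    moreover have "?K \<noteq> {}" using OK V0 by (metis empty_iff image_eqI subset_empty)
    moreover have "?K \<subseteq> Y" using KM MY by (rule subset_trans)
    ultimately have "?K \<in> \<A>" unfolding \<A>_def by simp
    then have "?K = M" using KM by (rule minM)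
    then have "x \<in> ?K" using x(1) by simp
    then have "\<exists>k. k \<in> ?O \<and> k \<in> U" unfolding in_closure_of using U(1,2) by simp
    then show ?thesis by auto
  qed
  have "compactin ?T M" by (rule closedin_compact_space[OF compact_space_config[OF A] clM])
  moreover have "M \<subseteq> \<Union>((\<lambda>v. {y \<in> topspace ?T. shift v y \<in> U}) ` V)"
    using hit subsetD[OF Mtop] by auto
  moreover have "openin ?T N" if "N \<in> (\<lambda>v. {y \<in> topspace ?T. shift v y \<in> U}) ` V" for N
    using that openin_continuous_map_preimage[OF continuous_map_shift U(2)] by auto
  ultimately have "\<exists>\<F>. finite \<F> \<and> \<F> \<subseteq> (\<lambda>v. {y \<in> topspace ?T. shift v y \<in> U}) ` V \<and> M \<subseteq> \<Union>\<F>"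
    by (intro compactinD)
  then obtain \<F> where \<F>: "finite \<F>" "\<F> \<subseteq> (\<lambda>v. {y \<in> topspace ?T. shift v y \<in> U}) ` V" "M \<subseteq> \<Union>\<F>"
    by (elim exE conjE)
  then obtain K where K: "finite K" "K \<subseteq> V" "\<F> = (\<lambda>v. {y \<in> topspace ?T. shift v y \<in> U}) ` K"
    using finite_subset_image[OF \<F>(1,2)] by (elim exE conjE)
  have "M \<subseteq> (\<lambda>v. shift (- v) x) ` K"
  proof
    fix y assume y: "y \<in> M"
    then obtain v where v: "v \<in> K" "shift v y \<in> U" using subsetD[OF \<F>(3) y] K(3) by auto
    then have "shift v y = x" using subsetD[OF K(2)] by (intro Ux Minv y)
    then have "shift (- v) x = y" by (auto simp: shift_def)
    then show "y \<in> (\<lambda>v. shift (- v) x) ` K" using v(1) by auto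
  qed
  then have "finite M" by (rule finite_surj[OF K(1)])
  then show thesis using Mne MY Minv by (rule that)
qed

section \<open>The one-dimensional shift\<close>

definition reads :: "(int \<Rightarrow> 'a) \<Rightarrow> int \<Rightarrow> 'a list \<Rightarrow> bool" where
  "reads x v w \<longleftrightarrow> (\<forall>k<length w. x (v + int k) = w ! k)"

lemma occurs_in_word_pattern_iff: "occurs_in (word_pattern w) x \<longleftrightarrow> (\<exists>v. reads x v w)"
proof -
  have "(\<forall>u\<in>dom (word_pattern w). word_pattern w u = Some (shift v x u)) \<longleftrightarrow> reads x v w" for v
  proof
    assume L: "\<forall>u\<in>dom (word_pattern w). word_pattern w u = Some (shift v x u)"
    show "reads x v w"
      unfolding reads_def
    proof (intro allI impI)
      fix k assume "k < length w"
      then show "x (v + int k) = w ! k"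
        using L[rule_format, of "int k"] by (simp add: word_pattern_def shift_def dom_def)
    qed
  next
    assume R: "reads x v w"
    show "\<forall>u\<in>dom (word_pattern w). word_pattern w u = Some (shift v x u)"
    proof
      fix u assume "u \<in> dom (word_pattern w)"
      then have "0 \<le> u" "u < int (length w)" by (auto simp: word_pattern_def split: if_splits)
      then show "word_pattern w u = Some (shift v x u)"
        using R[unfolded reads_def, rule_format, of "nat u"]
        by (simp add: word_pattern_def shift_def nat_less_iff)
    qed
  qed
  then show ?thesis by (simp add: occurs_in_def)
qed

definition zeros :: "(int \<Rightarrow> nat) \<Rightarrow> int \<Rightarrow> nat \<Rightarrow> bool" where
  "zeros x v n \<longleftrightarrow> (\<forall>c. v \<le> c \<longrightarrow> c < v + int n \<longrightarrow> x c = 0)"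

lemma reads_Nil: "reads x v []"
  by (simp add: reads_def)

lemma reads_Cons: "reads x v (a # w) \<longleftrightarrow> x v = a \<and> reads x (v + 1) w"
  by (simp add: reads_def All_less_Suc2 algebra_simps)

lemma reads_zeros_append:
  "reads x v (replicate n 0 @ w) \<longleftrightarrow> zeros x v n \<and> reads x (v + int n) w"
proof (induction n arbitrary: v)
  case (Suc n)
  have "zeros x v (Suc n) \<longleftrightarrow> x v = 0 \<and> zeros x (v + 1) n"
  proof
    assume R: "x v = 0 \<and> zeros x (v + 1) n"
    show "zeros x v (Suc n)" unfolding zeros_def
    proof (intro allI impI)
      fix c assume "v \<le> c" "c < v + int (Suc n)"
      then show "x c = 0" using R by (cases "c = v") (auto simp: zeros_def)
    qed
  qed (auto simp: zeros_def)
  then show ?case using Suc[of "v + 1"] by (auto simp: reads_Cons algebra_simps)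
qed (simp add: zeros_def)

text \<open>
  In the first family the position \<open>v\<close> is that of the middle \<open>1\<close>, not the start of the forbidden word, so
  that in all three families \<open>v\<close> is the \<open>1\<close> at the left end of a gap.
\<close>

lemma mem_Z_shift_iff:
  "x \<in> Z_shift \<longleftrightarrow> range x \<subseteq> {0, 1} \<and>
     (\<forall>m v. 0 < m \<longrightarrow> zeros x (v - int m) m \<longrightarrow> x v = 1 \<longrightarrow> zeros x (v + 1) m \<longrightarrow> x (v + 1 + int m) \<noteq> 1) \<and>
     (\<forall>n v. x v = 1 \<longrightarrow> zeros x (v + 1) n \<longrightarrow> x (v + 1 + int n) = 1 \<longrightarrow> x (v + 2 + int n) \<noteq> 1) \<and>
     (\<forall>n v. x v = 1 \<longrightarrow> zeros x (v + 1) n \<longrightarrow> x (v + 1 + int n) = 1 \<longrightarrow> \<not> zeros x (v + 2 + int n) (n + 2))"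
proof -
  have R0: "reads x v (replicate n 0) \<longleftrightarrow> zeros x v n" for v n
    using reads_zeros_append[of x v n "[]"] by (simp add: reads_Nil)
  have 1: "occurs_in (word_pattern (replicate m 0 @ [1] @ replicate m 0 @ [1])) x \<longleftrightarrow>
     (\<exists>v. zeros x (v - int m) m \<and> x v = 1 \<and> zeros x (v + 1) m \<and> x (v + 1 + int m) = 1)" (is "?L \<longleftrightarrow> ?R") for m
  proof -
    have "?L \<longleftrightarrow> (\<exists>v. zeros x v m \<and> x (v + int m) = 1 \<and> zeros x (v + int m + 1) m \<and> x (v + int m + 1 + int m) = 1)"
      by (simp add: occurs_in_word_pattern_iff reads_zeros_append reads_Cons reads_Nil)
    also have "\<dots> \<longleftrightarrow> ?R"
    proof
      assume "\<exists>v. zeros x v m \<and> x (v + int m) = 1 \<and> zeros x (v + int m + 1) m \<and> x (v + int m + 1 + int m) = 1"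
      then obtain v where "zeros x v m \<and> x (v + int m) = 1 \<and> zeros x (v + int m + 1) m \<and> x (v + int m + 1 + int m) = 1" ..
      then show ?R by (intro exI[of _ "v + int m"]) simp
    next
      assume ?R
      then obtain v where "zeros x (v - int m) m \<and> x v = 1 \<and> zeros x (v + 1) m \<and> x (v + 1 + int m) = 1" ..
      then show "\<exists>v. zeros x v m \<and> x (v + int m) = 1 \<and> zeros x (v + int m + 1) m \<and> x (v + int m + 1 + int m) = 1"
        by (intro exI[of _ "v - int m"]) simp
    qed
    finally show ?thesis .
  qed
  have 2: "occurs_in (word_pattern ([1] @ replicate n 0 @ [1, 1])) x \<longleftrightarrow>
     (\<exists>v. x v = 1 \<and> zeros x (v + 1) n \<and> x (v + 1 + int n) = 1 \<and> x (v + 2 + int n) = 1)" for n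
    by (simp add: occurs_in_word_pattern_iff reads_zeros_append reads_Cons reads_Nil algebra_simps)
  have 3: "occurs_in (word_pattern ([1] @ replicate n 0 @ [1] @ replicate (n + 2) 0)) x \<longleftrightarrow>
     (\<exists>v. x v = 1 \<and> zeros x (v + 1) n \<and> x (v + 1 + int n) = 1 \<and> zeros x (v + 2 + int n) (n + 2))" for n
    by (simp del: replicate_Suc add_2_eq_Suc' add: occurs_in_word_pattern_iff reads_zeros_append reads_Cons R0 algebra_simps)
  have "x \<in> Z_shift \<longleftrightarrow> range x \<subseteq> {0, 1} \<and>
     (\<forall>m>0. \<not> occurs_in (word_pattern (replicate m 0 @ [1] @ replicate m 0 @ [1])) x) \<and>
     (\<forall>n. \<not> occurs_in (word_pattern ([1] @ replicate n 0 @ [1, 1])) x) \<and>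
     (\<forall>n. \<not> occurs_in (word_pattern ([1] @ replicate n 0 @ [1] @ replicate (n + 2) 0)) x)"
    unfolding Z_shift_def avoiding_def forbidden_words_def \<Gamma>_def ball_simps image_Un ball_Un by auto
  then show ?thesis unfolding 1 2 3 by meson
qed

lemma shift_space_Z_shift: "shift_space \<Gamma> Z_shift"
  unfolding Z_shift_def
proof (rule shift_space_avoiding)
  show "finite \<Gamma>" by (simp add: \<Gamma>_def)
  have "word_pattern w \<in> patterns \<Gamma>" if "set w \<subseteq> \<Gamma>" for w
  proof -
    have "dom (word_pattern w) \<subseteq> {0..<int (length w)}"
      by (auto simp: word_pattern_def split: if_splits)
    then have "finite (dom (word_pattern w))" using finite_subset by blast
    moreover have "ran (word_pattern w) \<subseteq> set w"
      by (auto simp: ran_def word_pattern_def nat_less_iff split: if_splits)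
    ultimately show ?thesis using that by (auto simp: patterns_def)
  qed
  moreover have "set w \<subseteq> \<Gamma>" if "w \<in> forbidden_words" for w
    using that by (auto simp: forbidden_words_def \<Gamma>_def)
  ultimately show "word_pattern ` forbidden_words \<subseteq> patterns \<Gamma>" by auto
qed

text \<open>
  The triangular numbers, that is, the positions of the \<open>1\<close>s of \<open>z\<close>. The block of \<open>z\<close> that starts at
  \<open>tri n\<close> is \<open>1 0\<^sup>n\<close>.
\<close>

definition tri :: "nat \<Rightarrow> int" where
  "tri n = int n * (int n + 1) div 2"

lemma tri_0 [simp]: "tri 0 = 0"
  by (simp add: tri_def)

lemma tri_Suc: "tri (Suc n) = tri n + int n + 1"
proof -
  have "int (Suc n) * (int (Suc n) + 1) = int n * (int n + 1) + (int n + 1) * 2"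
    by (simp add: algebra_simps)
  then show ?thesis unfolding tri_def by simp
qed

lemma strict_mono_tri: "strict_mono tri"
  by (simp add: strict_mono_Suc_iff tri_Suc)

lemma tri_nonneg: "0 \<le> tri n"
  by (induction n) (simp_all add: tri_Suc)

lemma tri_decompose:
  assumes "0 \<le> k"
  obtains n r where "k = tri n + int r" "r \<le> n"
proof -
  have "\<exists>n r. int m = tri n + int r \<and> r \<le> n" for m
  proof (induction m)
    case (Suc m)
    then obtain n r where nr: "int m = tri n + int r" "r \<le> n" by blast
    show ?case
    proof (cases "r = n")
      case True
      then show ?thesis using nr by (intro exI[of _ "Suc n"] exI[of _ 0]) (simp add: tri_Suc)
    next
      case False
      then show ?thesis using nr by (intro exI[of _ n] exI[of _ "Suc r"]) simp
    qed
  qed (auto intro: exI[of _ 0])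
  from this[of "nat k"] show thesis using assms that by auto
qed

lemma z_config_tri: "z_config i = (if i \<in> range tri then 1 else 0)"
proof -
  have "(\<exists>n\<ge>0. i = n * (n + 1) div 2) \<longleftrightarrow> i \<in> range tri"
  proof
    assume "\<exists>n\<ge>0. i = n * (n + 1) div 2"
    then obtain n where "0 \<le> n" "i = n * (n + 1) div 2" by blast
    then have "i = tri (nat n)" by (simp add: tri_def)
    then show "i \<in> range tri" by blast
  next
    assume "i \<in> range tri"
    then obtain n where "i = int n * (int n + 1) div 2" by (auto simp: tri_def)
    then show "\<exists>n\<ge>0. i = n * (n + 1) div 2" by (intro exI[of _ "int n"]) simp
  qed
  then show ?thesis by (simp add: z_config_def)
qed

lemma z_config_eq_1_iff: "z_config i = 1 \<longleftrightarrow> (\<exists>n. i = tri n)"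
  by (auto simp: z_config_tri)

lemma z_config_neg: "i < 0 \<Longrightarrow> z_config i = 0"
  using tri_nonneg by (auto simp: z_config_tri not_le[symmetric])

lemma z_config_between:
  assumes "r \<le> n"
  shows "z_config (tri n + int r) = (if r = 0 then 1 else 0)"
proof (cases "r = 0")
  case False
  have "tri n + int r \<noteq> tri m" for m
  proof
    assume m: "tri n + int r = tri m"
    then have "tri n < tri m" "tri m < tri (Suc n)" using False assms by (auto simp: tri_Suc)
    then have "n < m" "m < Suc n" by (simp_all only: strict_mono_less[OF strict_mono_tri])
    then show False by simp
  qed
  then show ?thesis using False by (auto simp: z_config_tri)
qed (simp add: z_config_tri)

lemma z_config_gap:
  assumes "z_config v = 1" "zeros z_config (v + 1) n" "z_config (v + 1 + int n) = 1"
  shows "v = tri n"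
proof -
  obtain a b where a: "v = tri a" and b: "v + 1 + int n = tri b"
    using assms unfolding z_config_eq_1_iff by blast
  have "tri a < tri b" using a b by simp
  then have "a < b" by (simp only: strict_mono_less[OF strict_mono_tri])
  have "b = Suc a"
  proof (rule ccontr)
    assume "b \<noteq> Suc a"
    then have "tri (Suc a) < tri b" "tri a < tri (Suc a)"
      using \<open>a < b\<close> by (simp_all only: strict_mono_less[OF strict_mono_tri])
    then have "z_config (tri (Suc a)) = 0"
      using assms(2) a b by (simp add: zeros_def)
    then show False by (simp add: z_config_tri)
  qed
  then show ?thesis using a b by (simp add: tri_Suc)
qed

lemma z_config_in_Z_shift: "z_config \<in> Z_shift"
  unfolding mem_Z_shift_iff
proof (intro conjI allI impI notI)
  show "range z_config \<subseteq> {0, 1}" by (auto simp: z_config_tri)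
  fix v :: int and n m :: nat
  show False if m: "0 < m" and *: "zeros z_config (v - int m) m" "z_config v = 1"
    "zeros z_config (v + 1) m" "z_config (v + 1 + int m) = 1"
  proof -
    have "v = tri m" using z_config_gap * by blast
    moreover obtain k where k: "m = Suc k" using m by (cases m) auto
    ultimately have "v - int m = tri k" by (simp add: tri_Suc)
    then have "z_config (v - int m) = 1" by (simp add: z_config_tri)
    moreover have "z_config (v - int m) = 0" using *(1) m by (simp add: zeros_def)
    ultimately show False by simp
  qed
  show False if *: "z_config v = 1" "zeros z_config (v + 1) n" "z_config (v + 1 + int n) = 1"
    "z_config (v + 2 + int n) = 1"
  proof -
    have "v = tri n" using z_config_gap * by blast
    moreover have "v + 1 + int n = tri 0"
      by (rule z_config_gap) (use * in \<open>simp_all add: zeros_def add_ac\<close>)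
    ultimately show False using tri_nonneg[of n] by simp
  qed
  show False if *: "z_config v = 1" "zeros z_config (v + 1) n" "z_config (v + 1 + int n) = 1"
    "zeros z_config (v + 2 + int n) (n + 2)"
  proof -
    have "v = tri n" using z_config_gap * by blast
    then have "v + 3 + 2 * int n = tri (Suc (Suc n))" by (simp add: tri_Suc)
    then have "z_config (v + 3 + 2 * int n) = 1" unfolding z_config_eq_1_iff by blast
    then show False using *(4) by (simp add: zeros_def)
  qed
qed

context
  fixes x assumes x: "x \<in> Z_shift"
begin

lemma Z_shift_01: "x c = 0 \<or> x c = 1"
  using x by (auto simp: mem_Z_shift_iff)

lemma Z_shift_no_repeated_gap:
  "0 < m \<Longrightarrow> zeros x (v - int m) m \<Longrightarrow> x v = 1 \<Longrightarrow> zeros x (v + 1) m \<Longrightarrow> x (v + 1 + int m) = 1 \<Longrightarrow> False"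
  using x by (simp add: mem_Z_shift_iff)

lemma Z_shift_no_late_11:
  "x v = 1 \<Longrightarrow> zeros x (v + 1) n \<Longrightarrow> x (v + 1 + int n) = 1 \<Longrightarrow> x (v + 2 + int n) = 1 \<Longrightarrow> False"
  using x by (simp add: mem_Z_shift_iff)

lemma Z_shift_no_long_gap:
  "x v = 1 \<Longrightarrow> zeros x (v + 1) n \<Longrightarrow> x (v + 1 + int n) = 1 \<Longrightarrow> zeros x (v + 2 + int n) (n + 2) \<Longrightarrow> False"
  using x by (simp add: mem_Z_shift_iff)

text \<open>
  Descent on the distance of two \<open>1\<close>s. If there is a \<open>1\<close> strictly between them they can be brought closer
  together; if there is none, they bound a gap, and the zeros before the left one must be fewer than
  in this gap, so a shorter gap precedes it.
\<close>

lemma Z_shift_has_11: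
  assumes "x s = 1" "x t = 1" "s < t"
  obtains p where "x p = 1" "x (p + 1) = 1"
proof -
  have "\<exists>p. x p = 1 \<and> x (p + 1) = 1" if "x s = 1" "x (s + 1 + int m) = 1" for m s
    using that
  proof (induction m arbitrary: s rule: less_induct)
    case (less m)
    show ?case
    proof (cases "m = 0")
      case True
      then show ?thesis using less.prems by auto
    next
      case m: False
      show ?thesis
      proof (cases "zeros x (s + 1) m")
        case True
        then obtain c where c: "s - int m \<le> c" "c < s" "x c = 1"
          using Z_shift_no_repeated_gap[of m s] Z_shift_01 m less.prems by (auto simp: zeros_def)
        show ?thesis
          by (rule less.IH[of "nat (s - c - 1)" c]) (use c less.prems m in auto)
      next
        case False
        then obtain c where c: "s + 1 \<le> c" "c < s + 1 + int m" "x c = 1"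
          using Z_shift_01 unfolding zeros_def by blast
        show ?thesis
          by (rule less.IH[of "nat (c - s - 1)" s]) (use c less.prems in auto)
      qed
    qed
  qed
  from this[of s "nat (t - s - 1)"] show thesis using assms that by auto
qed

text \<open>
  To the left of \<open>11\<close> no further \<open>1\<close> can occur. To the right, after a gap of \<open>n\<close> zeros, the next \<open>1\<close> has
  to come within \<open>n + 1\<close> zeros, and it cannot come after at most \<open>n\<close> zeros: that would be a late \<open>11\<close> or
  a gap preceded by at least as many zeros.
\<close>

lemma Z_shift_11_determines:
  assumes p: "x p = 1" "x (p + 1) = 1"
  shows "x = shift (- p) z_config"
proof -
  have left: "x (p - 1 - int n) = 0" for n
  proof (induction n rule: less_induct)
    case (less n)
    have "zeros x (p - 1 - int n + 1) n"
      unfolding zeros_def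
    proof (intro allI impI)
      fix c assume "p - 1 - int n + 1 \<le> c" "c < p - 1 - int n + 1 + int n"
      then show "x c = 0" using less[of "nat (p - 1 - c)"] by simp
    qed
    then show ?case
      using Z_shift_no_late_11[of "p - 1 - int n" n] Z_shift_01[of "p - 1 - int n"] p by (auto simp: add.commute)
  qed
  have right: "x (p + tri n) = 1 \<and> zeros x (p + tri n + 1) n \<and> x (p + tri (Suc n)) = 1" for n
  proof (induction n)
    case 0
    then show ?case using p by (simp add: tri_Suc zeros_def)
  next
    case (Suc n)
    define v where "v = p + tri n"
    define w where "w = p + tri (Suc n)"
    have w: "w = v + 1 + int n" by (simp add: v_def w_def tri_Suc)
    have v1: "x v = 1" "zeros x (v + 1) n" "x w = 1" using Suc by (auto simp: v_def w_def)
    then obtain c where c: "v + 2 + int n \<le> c" "c < v + 2 + int n + int (n + 2)" "x c = 1"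
      using Z_shift_no_long_gap[of v n] Z_shift_01 w by (auto simp: zeros_def)
    define m where "m = (LEAST m. x (w + 1 + int m) = 1)"
    have ex: "x (w + 1 + int (nat (c - w - 1))) = 1" using c w by simp
    then have m1: "x (w + 1 + int m) = 1" unfolding m_def by (rule LeastI)
    have "m \<le> nat (c - w - 1)" unfolding m_def using ex by (rule Least_le)
    then have m_le: "m \<le> n + 1" using c w by linarith
    have mz: "zeros x (w + 1) m" unfolding zeros_def
    proof (intro allI impI)
      fix d assume d: "w + 1 \<le> d" "d < w + 1 + int m"
      then have "nat (d - w - 1) < m" by linarith
      then have "x (w + 1 + int (nat (d - w - 1))) \<noteq> 1" unfolding m_def by (rule not_less_Least)
      then show "x d = 0" using d Z_shift_01[of d] by simp
    qed
    have "m \<noteq> 0"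
    proof
      assume "m = 0"
      then have "x (v + 2 + int n) = 1" using m1 w by (simp add: algebra_simps)
      then show False using Z_shift_no_late_11[of v n] v1 w by simp
    qed
    moreover have "\<not> m \<le> n"
    proof
      assume "m \<le> n"
      then have "zeros x (w - int m) m" using v1(2) w by (simp add: zeros_def)
      then show False using Z_shift_no_repeated_gap[of m w] \<open>m \<noteq> 0\<close> v1(3) mz m1 by simp
    qed
    ultimately have "m = Suc n" using m_le by simp
    then show ?case using v1(3) mz m1 by (simp add: w_def tri_Suc add_ac)
  qed
  have "x (p + k) = z_config k" for k
  proof (cases "k < 0")
    case True
    then show ?thesis using left[of "nat (- k - 1)"] by (simp add: z_config_neg)
  next
    case False
    then obtain n r where k: "k = tri n + int r" "r \<le> n" using tri_decompose[of k] by auto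
    show ?thesis
    proof (cases "r = 0")
      case True
      then show ?thesis using right[of n] k by (simp add: z_config_tri)
    next
      case False
      then have "x (p + tri n + int r) = 0" using right[of n] k by (simp add: zeros_def)
      then show ?thesis using k False by (simp add: z_config_between add.assoc)
    qed
  qed
  from this[of "c - p" for c] show ?thesis by (simp add: shift_def fun_eq_iff)
qed

lemma Z_shift_cases:
  "x = (\<lambda>_. 0) \<or> (\<exists>p. x = (\<lambda>c. if c = p then 1 else 0)) \<or> (\<exists>v. x = shift v z_config)"
proof (cases "\<exists>s t. x s = 1 \<and> x t = 1 \<and> s < t")
  case True
  then show ?thesis using Z_shift_has_11 Z_shift_11_determines by metis
next
  case False
  show ?thesis
  proof (cases "\<exists>p. x p = 1")
    case True
    then obtain p where p: "x p = 1" ..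
    have "x c = (if c = p then 1 else 0)" for c
      using False p Z_shift_01[of c] by (metis linorder_neqE)
    then show ?thesis by blast
  next
    case False
    then show ?thesis using Z_shift_01 by blast
  qed
qed

end

lemma countable_Z_shift: "countable Z_shift"
proof (rule countable_subset)
  show "Z_shift \<subseteq> {\<lambda>_. 0} \<union> range (\<lambda>p c. if c = p then 1 else 0) \<union> range (\<lambda>v. shift v z_config)"
    using Z_shift_cases by blast
qed simp

lemma finite_bounded_image:
  fixes f :: "'b \<Rightarrow> int"
  assumes "finite W"
  obtains N :: nat where "\<And>w. w \<in> W \<Longrightarrow> \<bar>f w\<bar> \<le> int N"
proof -
  have "\<exists>N::nat. \<forall>w\<in>W. \<bar>f w\<bar> \<le> int N"
    using assms
  proof (induction rule: finite_induct)
    case (insert a W)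
    then obtain N where N: "\<forall>w\<in>W. \<bar>f w\<bar> \<le> int N" by blast
    show ?case
    proof (intro exI[of _ "N + nat \<bar>f a\<bar>"] ballI)
      fix w assume "w \<in> insert a W"
      then show "\<bar>f w\<bar> \<le> int (N + nat \<bar>f a\<bar>)" using N by force
    qed
  qed auto
  then show thesis using that by blast
qed

text \<open>
  The configuration \<open>0\<close> is the limit of \<open>z\<close> seen from further and further to the left of its first \<open>1\<close>, and
  the configurations with a single \<open>1\<close> are limits of \<open>z\<close> seen from \<open>tri n\<close>, where the two adjacent gaps
  grow with \<open>n\<close>.
\<close>

lemma Z_shift_eq_orbit_closure: "Z_shift = orbit_closure \<Gamma> z_config"
proof
  show "orbit_closure \<Gamma> z_config \<subseteq> Z_shift"
    by (rule orbit_closure_minimal[OF shift_space_Z_shift z_config_in_Z_shift])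
  have rz: "range (shift v z_config) \<subseteq> \<Gamma>" for v
    by (auto simp: shift_def z_config_tri \<Gamma>_def)
  show "Z_shift \<subseteq> orbit_closure \<Gamma> z_config"
  proof
    fix x assume x: "x \<in> Z_shift"
    have approx: "\<exists>v. agree_on W x (shift v z_config)" if W: "finite W" for W
    proof -
      obtain N where N: "\<And>w. w \<in> W \<Longrightarrow> \<bar>w\<bar> \<le> int N" using finite_bounded_image[OF W, of "\<lambda>w. w"] by blast
      from Z_shift_cases[OF x] show ?thesis
      proof (elim disjE exE)
        assume "x = (\<lambda>_. 0)"
        then have "agree_on W x (shift (- int N - 1) z_config)"
          using N by (force simp: agree_on_def shift_def z_config_neg)
        then show ?thesis ..
      next
        fix v assume "x = shift v z_config"
        then show ?thesis by (auto simp: agree_on_def)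
      next
        fix p assume xp: "x = (\<lambda>c. if c = p then 1 else 0)"
        define M where "M = N + nat \<bar>p\<bar>"
        have "x w = shift (tri (Suc M) - p) z_config w" if w: "w \<in> W" for w
        proof -
          have k: "\<bar>w - p\<bar> \<le> int M" using N[OF w] by (simp add: M_def)
          show ?thesis
          proof (cases "w < p")
            case True
            have e: "tri (Suc M) - p + w = tri M + int (nat (int M + 1 + w - p))"
              using k by (simp add: tri_Suc)
            show ?thesis
              unfolding shift_def e using True k by (subst z_config_between) (auto simp: xp)
          next
            case False
            have e: "tri (Suc M) - p + w = tri (Suc M) + int (nat (w - p))"
              using False by simp
            show ?thesis
              unfolding shift_def e using False k by (subst z_config_between) (auto simp: xp)
          qed
        qed
        then show ?thesis unfolding agree_on_def by blast
      qed
    qed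
    have "range x \<subseteq> \<Gamma>" using x by (simp add: mem_Z_shift_iff \<Gamma>_def)
    then show "x \<in> orbit_closure \<Gamma> z_config"
      unfolding orbit_closure_def in_closure_of_config_iff
    proof (intro conjI allI impI)
      fix W :: "int set" assume "finite W"
      then obtain v where "agree_on W x (shift v z_config)"
        using approx by metis
      then show "\<exists>y\<in>range (\<lambda>v. shift v z_config). range y \<subseteq> \<Gamma> \<and> agree_on W x y"
        using rz[of v] by (intro bexI[of _ "shift v z_config"]) simp_all
    qed
  qed
qed

section \<open>Countable covers do not exist\<close>

lemma axis_add: "axis k (a + b) = axis k a + (axis k b :: int ^ 'd)"
  by (simp add: vec_eq_iff axis_def)

lemma axis_nth_if: "axis k a $ l = (if l = k then a else (0::int))"
  by (simp add: axis_def)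

definition lift :: "'d::finite \<Rightarrow> (int \<Rightarrow> 'a) \<Rightarrow> (int ^ 'd \<Rightarrow> 'a)" where
  "lift i y = (\<lambda>n. y (n $ i))"

lemma P_dag_eq_lift: "P_dag i Z = lift i ` Z"
  by (auto simp: P_dag_def lift_def image_def fun_eq_iff)

lemma shift_lift: "shift v (lift i y) = lift i (shift (v $ i) y)"
  by (simp add: shift_def lift_def)

text \<open>
  The contents of \<open>x\<close> in the slab of thickness \<open>2 N + 1\<close> around a hyperplane orthogonal to \<open>e\<^sub>i\<close> are
  determined by the values of the finitely many translates of \<open>x\<close> in the set \<open>M\<close> at the \<open>2 N + 1\<close> points
  where the \<open>i\<close>-axis meets the slab. So there are finitely many possible contents, and two of the
  infinitely many hyperplanes at triangular numbers have the same ones. The index starts at \<open>Suc a\<close>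
  because the \<open>1\<close> before the splice will be needed too.
\<close>

lemma repeated_column:
  fixes x :: "int ^ 'd::finite \<Rightarrow> 'a"
  assumes A: "finite A" and xA: "range x \<subseteq> A" and M: "finite ((\<lambda>u. shift u x) ` {u. u $ i = 0})"
  shows "\<exists>a b. a < b \<and> (\<forall>u. \<bar>u $ i\<bar> \<le> int N \<longrightarrow> x (u + axis i (tri (Suc a))) = x (u + axis i (tri (Suc b))))"
proof -
  define M where "M = (\<lambda>u. shift u x) ` {u. u $ i = 0}"
  define I where "I = M \<times> {- int N..int N}"
  define st where "st c = restrict (\<lambda>(m, a). m (axis i (c + a))) I" for c
  have "finite (I \<rightarrow>\<^sub>E A)" unfolding I_def using A assms(3) by (intro finite_PiE) (auto simp: M_def)
  moreover have "range (\<lambda>n. st (tri (Suc n))) \<subseteq> I \<rightarrow>\<^sub>E A"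
  proof -
    have "m n \<in> A" if m: "m \<in> M" for m n
    proof -
      obtain u where "m = shift u x" using m unfolding M_def by (elim imageE)
      then show ?thesis using xA by (simp add: shift_def range_subsetD)
    qed
    then have "st c \<in> I \<rightarrow>\<^sub>E A" for c unfolding st_def I_def by (intro restrict_PiE_iff[THEN iffD2]) simp
    then show ?thesis by (rule image_subsetI)
  qed
  ultimately have "finite (range (\<lambda>n. st (tri (Suc n))))" by (rule finite_subset[rotated])
  then have "\<not> inj (\<lambda>n. st (tri (Suc n)))" using finite_imageD by blast
  then obtain a b where ab: "a < b" "st (tri (Suc a)) = st (tri (Suc b))"
    unfolding inj_def by (metis linorder_neqE_nat)
  have "x (u + axis i (tri (Suc a))) = x (u + axis i (tri (Suc b)))" if u: "\<bar>u $ i\<bar> \<le> int N" for u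
  proof -
    define m where "m = shift (u - axis i (u $ i)) x"
    have "(m, u $ i) \<in> I" using u by (auto simp: m_def I_def M_def axis_nth_if)
    then have "m (axis i (tri (Suc a) + u $ i)) = m (axis i (tri (Suc b) + u $ i))"
      using fun_cong[OF ab(2), of "(m, u $ i)"] by (simp add: st_def)
    then show ?thesis by (simp add: m_def shift_def axis_add algebra_simps)
  qed
  then show ?thesis using ab(1) by blast
qed

text \<open>
  The splice. To the left of the hyperplane at \<open>tri (Suc a)\<close> the configuration \<open>x'\<close> is \<open>x\<close>, to the right it
  is \<open>x\<close> moved by the distance \<open>\<delta>\<close> to the hyperplane at \<open>tri (Suc b)\<close>. Since \<open>x\<close> looks alike around both,
  a window that extends at most \<open>N\<close> from its center in direction \<open>e\<^sub>i\<close> sees \<open>x\<close> only, so \<open>x'\<close> belongs to the SFT and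
  the block code maps it to the corresponding splice of \<open>z\<close>. There, the block \<open>1 0\<^sup>a\<close> is followed by a
  gap of \<open>b + 1 > a + 1\<close> zeros.
\<close>

lemma not_countably_covered_P_dag:
  fixes i :: "'d::finite"
  shows "\<not> countably_covered \<Gamma> (P_dag i Z_shift)"
proof
  assume "countably_covered \<Gamma> (P_dag i Z_shift)"
  then obtain A :: "nat set" and S and \<phi> where cov: "sft_cover A S \<phi> \<Gamma> (P_dag i Z_shift)"
    and cS: "countable S"
    unfolding countably_covered_def by auto
  have bc: "block_code A S \<Gamma> (P_dag i Z_shift) \<phi>" and im: "\<phi> ` S = P_dag i Z_shift"
    and A: "finite A" and clS: "closedin (config_topology A) S"
    and cont: "continuous_map (subtopology (config_topology A) S)
      (subtopology (config_topology \<Gamma>) (P_dag i Z_shift)) \<phi>"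
    and invS: "\<And>v x. x \<in> S \<Longrightarrow> shift v x \<in> S"
    and comm: "\<And>v x. x \<in> S \<Longrightarrow> \<phi> (shift v x) = shift v (\<phi> x)"
    using cov by (auto simp: sft_cover_def is_sft_def block_code_def shift_space_def)
  obtain F where F: "finite F" "F \<subseteq> patterns A" "S = avoiding A F"
    using cov by (auto simp: sft_cover_def is_sft_def)
  define z where "z = (lift i z_config :: int ^ 'd \<Rightarrow> nat)"
  have z: "z \<in> P_dag i Z_shift" using z_config_in_Z_shift by (simp add: z_def P_dag_eq_lift)
  define Y where "Y = {x \<in> S. \<phi> x = z}"
  have "closedin (config_topology A) Y"
  proof -
    have "z \<in> topspace (config_topology \<Gamma>)"
      by (auto simp: topspace_config z_def lift_def z_config_tri \<Gamma>_def)
    then have "closedin (subtopology (config_topology \<Gamma>) (P_dag i Z_shift)) {z}"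
      using z by (simp add: closedin_Hausdorff_sing_eq Hausdorff_space_subtopology Hausdorff_space_config)
    from closedin_continuous_map_preimage[OF cont this]
    have "closedin (subtopology (config_topology A) S) {x \<in> topspace (subtopology (config_topology A) S). \<phi> x \<in> {z}}" .
    moreover have "{x \<in> topspace (subtopology (config_topology A) S). \<phi> x \<in> {z}} = Y"
      using closedin_subset[OF clS] by (auto simp: Y_def)
    ultimately show ?thesis using clS closedin_trans_full by fastforce
  qed
  moreover have "Y \<noteq> {}"
  proof -
    have "z \<in> \<phi> ` S" using im z by simp
    then show ?thesis by (auto simp: Y_def)
  qed
  moreover have "countable Y" using cS by (rule countable_subset[rotated]) (auto simp: Y_def)
  moreover have "shift v x \<in> Y" if "v \<in> {v. v $ i = 0}" "x \<in> Y" for v x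
    using that comm invS by (simp add: Y_def z_def shift_lift) (simp add: shift_def)
  ultimately obtain M where M: "finite M" "M \<noteq> {}" "M \<subseteq> Y"
    "\<And>v x. v \<in> {v. v $ i = 0} \<Longrightarrow> x \<in> M \<Longrightarrow> shift v x \<in> M"
    by (rule finite_invariant_subset[where V = "{v. v $ i = 0}", OF A]) simp_all
  obtain x where xM: "x \<in> M" using M(2) by auto
  then have x: "x \<in> S" "\<phi> x = z" using subsetD[OF M(3)] by (auto simp: Y_def)
  have xA: "range x \<subseteq> A" using x(1) by (simp add: F(3) avoiding_def)
  obtain W where W: "finite W"
    "\<And>x y. x \<in> S \<Longrightarrow> y \<in> S \<Longrightarrow> agree_on W x y \<Longrightarrow> \<phi> x 0 = \<phi> y 0"
    using block_code_window[OF bc, where v = 0] by metis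
  \<comment> \<open>All cells that the forbidden patterns and the block code look at.\<close>
  define D where "D = W \<union> \<Union>(dom ` F)"
  have "finite D" using W(1) F(1,2) by (auto simp: D_def patterns_def)
  then obtain N where N: "\<And>w. w \<in> D \<Longrightarrow> \<bar>w $ i\<bar> \<le> int N"
    using finite_bounded_image[of D "\<lambda>w. w $ i"] by metis
  have "(\<lambda>u. shift u x) ` {u. u $ i = 0} \<subseteq> M" using M(4) xM by auto
  then have fin: "finite ((\<lambda>u. shift u x) ` {u. u $ i = 0})" using M(1) by (rule finite_subset)
  obtain a b where "a < b"
    and rep: "\<And>u. \<bar>u $ i\<bar> \<le> int N \<Longrightarrow> x (u + axis i (tri (Suc a))) = x (u + axis i (tri (Suc b)))"
    using repeated_column[OF A xA fin, of N] by (elim exE conjE) simp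
  define s where "s = tri (Suc a)"
  define \<delta> where "\<delta> = axis i (tri (Suc b) - s)"
  have \<delta>_nth: "\<delta> $ i = tri (Suc b) - s" by (simp add: \<delta>_def axis_nth_if)
  have near: "x u = x (\<delta> + u)" if "\<bar>u $ i - s\<bar> \<le> int N" for u
  proof -
    have "x (u - axis i s + axis i s) = x (u - axis i s + axis i (tri (Suc b)))"
      unfolding s_def by (rule rep) (use that in \<open>simp add: axis_nth_if s_def\<close>)
    moreover have "axis i (tri (Suc b)) = \<delta> + axis i s" by (simp add: \<delta>_def axis_add[symmetric])
    ultimately show ?thesis by (simp add: algebra_simps)
  qed
  define x' where "x' u = (if u $ i \<le> s then x u else x (\<delta> + u))" for u
  \<comment> \<open>The place in \<open>x\<close> that \<open>x'\<close> copies around \<open>v\<close>.\<close>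
  define src where "src v = (if v $ i \<le> s then v else \<delta> + v)" for v
  have loc: "shift v x' w = shift (src v) x w" if w: "\<bar>w $ i\<bar> \<le> int N" for v w
  proof (cases "v $ i \<le> s \<longleftrightarrow> (v + w) $ i \<le> s")
    case True
    then show ?thesis by (simp add: x'_def src_def shift_def add.assoc)
  next
    case False
    then have "x (v + w) = x (\<delta> + (v + w))" using w by (intro near) auto
    then show ?thesis by (simp add: x'_def src_def shift_def add.assoc)
  qed
  have x'S: "x' \<in> S"
    unfolding F(3) avoiding_def
  proof (intro CollectI conjI ballI notI)
    show "range x' \<subseteq> A" using xA by (auto simp: x'_def)
    fix p assume p: "p \<in> F" and "occurs_in p x'"
    then obtain v where v: "\<forall>w\<in>dom p. p w = Some (shift v x' w)" by (auto simp: occurs_in_def)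
    have "p w = Some (shift (src v) x w)" if "w \<in> dom p" for w
    proof -
      have "w \<in> D" using that p by (auto simp: D_def)
      then show ?thesis using bspec[OF v that] loc N by simp
    qed
    then have "occurs_in p x" unfolding occurs_in_def by blast
    then show False using x(1) p by (auto simp: F(3) avoiding_def)
  qed
  have \<phi>x': "\<phi> x' v = z_config (src v $ i)" for v
  proof -
    have "\<phi> x' v = \<phi> (shift v x') 0" using comm[OF x'S, of v] by (simp add: shift_def)
    also have "\<dots> = \<phi> (shift (src v) x) 0"
      using loc N by (intro W(2) invS x(1) x'S) (simp add: agree_on_def D_def)
    also have "\<dots> = z (src v)" using comm[OF x(1), of "src v"] x(2) by (simp add: shift_def)
    finally show ?thesis by (simp add: z_def lift_def)
  qed
  have "\<phi> x' \<in> P_dag i Z_shift" using im x'S by auto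
  then obtain y where y: "y \<in> Z_shift" "\<phi> x' = lift i y" unfolding P_dag_eq_lift by (elim imageE)
  have y_eq: "y c = z_config (if c \<le> s then c else c + (tri (Suc b) - s))" for c
    using \<phi>x'[of "axis i c"] by (simp add: y(2) lift_def axis_nth_if src_def \<delta>_nth add.commute)
  have s: "s = tri a + int a + 1" by (simp add: s_def tri_Suc)
  show False
  proof (rule Z_shift_no_long_gap[OF y(1), of "tri a" a])
    show "y (tri a) = 1" by (simp add: y_eq s z_config_tri)
    have "y s = 1" by (simp add: y_eq s_def z_config_tri)
    then show "y (tri a + 1 + int a) = 1" by (simp add: s add_ac)
    show "zeros y (tri a + 1) a"
      unfolding zeros_def
    proof (intro allI impI)
      fix c assume c: "tri a + 1 \<le> c" "c < tri a + 1 + int a"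
      then have "z_config (tri a + int (nat (c - tri a))) = 0" by (subst z_config_between) auto
      then show "y c = 0" using c by (simp add: y_eq s)
    qed
    show "zeros y (tri a + 2 + int a) (a + 2)"
      unfolding zeros_def
    proof (intro allI impI)
      fix c assume c: "tri a + 2 + int a \<le> c" "c < tri a + 2 + int a + int (a + 2)"
      then have "z_config (tri (Suc b) + int (nat (c - s))) = 0"
        using \<open>a < b\<close> s by (subst z_config_between) auto
      then show "y c = 0" using c s by (simp add: y_eq algebra_simps)
    qed
  qed
qed

section \<open>Marked configurations\<close>

datatype side = Before | At | After

text \<open>
  The horizontally adjacent pairs that may occur in a word \<open>Before \<dots> Before At After \<dots> After\<close>.
\<close>

fun step :: "side \<Rightarrow> side \<Rightarrow> bool" where
  "step Before q \<longleftrightarrow> q \<noteq> After"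
| "step _ q \<longleftrightarrow> q = After"

text \<open>
  The columns \<open>c\<close> and \<open>c + 1\<close> of the layer \<open>D\<close> lie in the same block. Time, the second argument of \<open>D\<close>,
  runs in the vertical direction.
\<close>

definition glued :: "(int \<Rightarrow> int \<Rightarrow> side) \<Rightarrow> int \<Rightarrow> bool" where
  "glued D c \<longleftrightarrow> (\<forall>y. step (D c y) (D (c + 1) y) \<and> (D c y = At \<longleftrightarrow> D (c + 1) (y + 1) = At))"

lemma glued_diagonal:
  assumes "\<And>c. a \<le> c \<Longrightarrow> c < a + int k \<Longrightarrow> glued D c"
  shows "D (a + int k) (y + int k) = At \<longleftrightarrow> D a y = At"
  using assms
proof (induction k)
  case (Suc k)
  have "D (a + int k) (y + int k) = At \<longleftrightarrow> D (a + int k + 1) (y + int k + 1) = At"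
    using Suc.prems[of "a + int k"] by (simp add: glued_def)
  then show ?case using Suc by (simp add: add_ac)
qed simp

lemma glued_after_At:
  assumes "\<And>c. a \<le> c \<Longrightarrow> c < a + int k \<Longrightarrow> glued D c" and "D a y = At" and "0 < k"
  shows "D (a + int k) y = After"
  using assms(3,1)
proof (induction k rule: nat_induct_non_zero)
  case 1
  then have "step (D a y) (D (a + 1) y)" by (simp add: glued_def)
  then show ?case using assms(2) by simp
next
  case (Suc k)
  have "step (D (a + int k) y) (D (a + int k + 1) y)"
    using Suc.prems[of "a + int k"] by (simp add: glued_def)
  then show ?case using Suc by (simp add: add_ac)
qed

lemma run_has_At:
  assumes "\<And>c. a \<le> c \<Longrightarrow> c < a + int n \<Longrightarrow> glued D c"
    and "D a y \<noteq> After" and "D (a + int n) y \<noteq> Before"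
  obtains k where "k \<le> n" "D (a + int k) y = At"
proof -
  have "(\<exists>k\<le>n. D (a + int k) y = At) \<or> D (a + int n) y = Before"
    using assms(1)
  proof (induction n)
    case 0
    show ?case using assms(2) by (cases "D a y") auto
  next
    case (Suc n)
    then consider k where "k \<le> n" "D (a + int k) y = At" | "D (a + int n) y = Before" by auto
    then show ?case
    proof cases
      case 1
      then show ?thesis by (intro disjI1 exI[of _ k]) simp
    next
      case 2
      have "step (D (a + int n) y) (D (a + int (Suc n)) y)"
        using Suc.prems[of "a + int n"] by (simp add: glued_def add_ac)
      then show ?thesis using 2 by (cases "D (a + int (Suc n)) y") auto
    qed
  qed
  then show thesis using assms(3) that by blast
qed

text \<open>
  Comparing consecutive rows: when the unique \<open>At\<close> of a row sits at the right end of the block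
  \<open>{a..a + n}\<close>, the \<open>At\<close> of the next row cannot have come from the left, so it sits at the left end.
  Hence the period is the length \<open>n + 1\<close> of the block.
\<close>

lemma run_recurs:
  assumes glued: "\<And>c. a \<le> c \<Longrightarrow> c < a + int n \<Longrightarrow> glued D c"
    and start: "\<And>y. D a y \<noteq> After" and stop: "\<And>y. D (a + int n) y \<noteq> Before"
  obtains y where "D a y = At" "D a (y + int n + 1) = At"
proof -
  obtain k where k: "k \<le> n" "D (a + int k) 0 = At"
    using run_has_At[of a n D 0] assms by blast
  define y where "y = - int k"
  have y: "D a y = At" using glued_diagonal[of a k D y] glued k by (simp add: y_def)
  have e: "D (a + int n) (y + int n) = At" using glued_diagonal[of a n D y] glued y by simp
  obtain l where l: "l \<le> n" "D (a + int l) (y + int n + 1) = At"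
    using run_has_At[of a n D "y + int n + 1"] assms by blast
  have "l = 0"
  proof (rule ccontr)
    assume "l \<noteq> 0"
    then obtain m where m: "l = Suc m" by (cases l) auto
    have "D (a + int m) (y + int n) = At"
      using glued[of "a + int m"] l m by (simp add: glued_def add_ac)
    then have "D (a + int m + int (n - m)) (y + int n) = After"
      using l(1) m glued by (intro glued_after_At) auto
    then show False using e l(1) m by (simp add: of_nat_diff)
  qed
  then show thesis using that y l(2) by simp
qed

text \<open>
  The conditions on the plane. A block of layer \<open>A\<close> is \<open>1 0\<^sup>n\<close>, so \<open>c\<close> and \<open>c + 1\<close> are in the same block
  iff the color at \<open>c + 1\<close> is \<open>0\<close>. A block of layer \<open>B\<close> is \<open>0\<^sup>n\<close>; layer \<open>B\<close> carries no information at
  a \<open>1\<close>, where \<open>At\<close> is excluded. At a \<open>1\<close> in column \<open>c + 1\<close>, the end \<open>c\<close> of the \<open>A\<close>-block to the left is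
  coupled with the start \<open>c + 2\<close> of the \<open>B\<close>-block to the right. If column \<open>c + 2\<close> is a \<open>1\<close> as well, the
  coupling means that \<open>At\<close> never reaches the end \<open>c\<close>, so that the block ending there must be infinite.
\<close>

definition marked :: "(int \<Rightarrow> nat) \<Rightarrow> (int \<Rightarrow> int \<Rightarrow> side) \<Rightarrow> (int \<Rightarrow> int \<Rightarrow> side) \<Rightarrow> bool" where
  "marked C A B \<longleftrightarrow> (\<forall>c.
     (C (c + 1) = 0 \<longrightarrow> glued A c) \<and>
     (C (c + 1) = 1 \<longrightarrow> (\<forall>y. A c y \<noteq> Before \<and> A (c + 1) y \<noteq> After \<and> (A c y = At \<longleftrightarrow> B (c + 2) y = At))) \<and>
     (C c = 0 \<longrightarrow> C (c + 1) = 0 \<longrightarrow> glued B c) \<and>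
     (C c = 1 \<longrightarrow> (\<forall>y. B c y \<noteq> At)) \<and>
     (C c = 1 \<longrightarrow> C (c + 1) = 0 \<longrightarrow> (\<forall>y. B (c + 1) y \<noteq> After)) \<and>
     (C c = 0 \<longrightarrow> C (c + 1) = 1 \<longrightarrow> (\<forall>y. B c y \<noteq> Before)))"

text \<open>
  Each family of forbidden words contradicts the coupling. In \<open>0\<^sup>m 1 0\<^sup>m 1\<close> the right gap makes \<open>At\<close> pass
  the middle \<open>1\<close> at times \<open>y\<close> and \<open>y + m\<close>, but the left block, of at least \<open>m + 1\<close> cells, would then
  contain two \<open>At\<close>s at time \<open>y\<close>. In \<open>1 0\<^sup>n 1 1\<close> the finite block makes \<open>At\<close> reach its end,
  which \<open>11\<close> excludes. In \<open>1 0\<^sup>n 1 0\<^sup>n\<^sup>+\<^sup>2\<close> the block makes \<open>At\<close> pass the second \<open>1\<close> at times \<open>y\<close> and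
  \<open>y + n + 1\<close>, and the \<open>n + 2\<close> zeros to the right would contain two \<open>At\<close>s at the latter time.
\<close>

lemma marked_imp_Z_shift:
  assumes C: "range C \<subseteq> {0, 1}" and m: "marked C A B"
  shows "C \<in> Z_shift"
proof -
  have glA: "glued A c" if "C (c + 1) = 0" for c using m that by (simp add: marked_def)
  have endA: "A c y \<noteq> Before" if "C (c + 1) = 1" for c y using m that by (simp add: marked_def)
  have startA: "A c y \<noteq> After" if "C c = 1" for c y
    using m[unfolded marked_def, rule_format, of "c - 1"] that by simp
  have AB: "A c y = At \<longleftrightarrow> B (c + 2) y = At" if "C (c + 1) = 1" for c y
    using m that by (simp add: marked_def)
  have glB: "glued B c" if "C c = 0" "C (c + 1) = 0" for c using m that by (simp add: marked_def)
  have B1: "B c y \<noteq> At" if "C c = 1" for c y using m that by (simp add: marked_def)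
  have startB: "B (c + 1) y \<noteq> After" if "C c = 1" "C (c + 1) = 0" for c y
    using m that by (simp add: marked_def)
  have endB: "B c y \<noteq> Before" if "C c = 0" "C (c + 1) = 1" for c y
    using m that by (simp add: marked_def)
  have gapA: "\<exists>y. A (v + int n) y = At \<and> A (v + int n) (y + int n + 1) = At"
    if v: "C v = 1" "zeros C (v + 1) n" "C (v + 1 + int n) = 1" for v n
  proof -
    have gl: "glued A c" if "v \<le> c" "c < v + int n" for c
      using glA[of c] v(2) that by (simp add: zeros_def)
    obtain y where y: "A v y = At" "A v (y + int n + 1) = At"
    proof (rule run_recurs[of v n A])
      show "A v y \<noteq> After" for y using v(1) by (rule startA)
      show "A (v + int n) y \<noteq> Before" for y using v(3) endA[of "v + int n"] by (simp add: add_ac)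
    qed (use gl in auto)
    have diag: "A (v + int n) (u + int n) = At \<longleftrightarrow> A v u = At" for u
      by (rule glued_diagonal) (use gl in auto)
    have "A (v + int n) (y + int n) = At" "A (v + int n) (y + int n + 1 + int n) = At"
      by (simp_all only: diag y)
    then show ?thesis by (intro exI[of _ "y + int n"]) (simp add: add_ac)
  qed
  show ?thesis
    unfolding mem_Z_shift_iff
  proof (intro conjI allI impI notI)
    show "range C \<subseteq> {0, 1}" by (rule C)
    fix v :: int and n m :: nat
    show False if *: "0 < m" "zeros C (v - int m) m" "C v = 1" "zeros C (v + 1) m" "C (v + 1 + int m) = 1"
    proof -
      obtain k where k: "m = Suc k" using *(1) by (cases m) auto
      obtain y where y: "B (v + 1) y = At" "B (v + 1) (y + int k + 1) = At"
      proof (rule run_recurs[of "v + 1" k B])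
        show "glued B c" if "v + 1 \<le> c" "c < v + 1 + int k" for c
          using *(4) that k by (intro glB) (simp_all add: zeros_def)
        show "B (v + 1) y \<noteq> After" for y using * by (intro startB) (simp_all add: zeros_def)
        show "B (v + 1 + int k) y \<noteq> Before" for y
          using * k by (intro endB) (simp_all add: zeros_def add_ac)
      qed auto
      have A: "A (v - 1) y = At" "A (v - 1) (y + int m) = At"
        using AB[of "v - 1"] *(3) y k by (simp_all add: add_ac)
      have gl: "glued A c" if "v - 1 - int m \<le> c" "c < v - 1 - int m + int m" for c
        using *(2) that by (intro glA) (simp add: zeros_def)
      have "A (v - 1 - int m) y = At"
        using glued_diagonal[of "v - 1 - int m" m A y] gl A(2) by simp
      then have "A (v - 1) y = After"
        using glued_after_At[of "v - 1 - int m" m A y] gl *(1) by simp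
      then show False using A(1) by simp
    qed
    show False if *: "C v = 1" "zeros C (v + 1) n" "C (v + 1 + int n) = 1" "C (v + 2 + int n) = 1"
    proof -
      obtain y where "A (v + int n) y = At" using gapA[of v n] * by auto
      then have "B (v + int n + 2) y = At" using AB[of "v + int n" y] *(3) by (simp add: add_ac)
      then show False using B1[of "v + int n + 2" y] *(4) by (simp add: add_ac)
    qed
    show False if *: "C v = 1" "zeros C (v + 1) n" "C (v + 1 + int n) = 1"
      "zeros C (v + 2 + int n) (n + 2)"
    proof -
      obtain y where "A (v + int n) y = At" "A (v + int n) (y + int n + 1) = At"
        using gapA[of v n] * by auto
      then have B: "B (v + int n + 2) y = At" "B (v + int n + 2) (y + int n + 1) = At"
        using AB[of "v + int n"] *(3) by (simp_all add: add_ac)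
      have gl: "glued B c" if "v + int n + 2 \<le> c" "c < v + int n + 2 + int (Suc n)" for c
        using *(4) that by (intro glB) (simp_all add: zeros_def)
      have "B (v + int n + 2 + int (Suc n)) (y + int (Suc n)) = At"
        using glued_diagonal[of "v + int n + 2" "Suc n" B y] gl B(1) by blast
      moreover have "B (v + int n + 2 + int (Suc n)) (y + int n + 1) = After"
        using glued_after_At[of "v + int n + 2" "Suc n" B "y + int n + 1"] gl B(2) by blast
      ultimately show False by (simp add: add_ac)
    qed
  qed
qed

definition mark :: "int \<Rightarrow> int \<Rightarrow> side" where
  "mark k r = (if k < r then Before else if k = r then At else After)"

definition row :: "int \<Rightarrow> nat" where
  "row c = (LEAST n. c < tri (Suc n))"

lemma row_tri:
  assumes "r \<le> n"
  shows "row (tri n + int r) = n"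
  unfolding row_def
proof (rule Least_equality)
  show "tri n + int r < tri (Suc n)" using assms by (simp add: tri_Suc)
  fix m assume "tri n + int r < tri (Suc m)"
  then have "tri n < tri (Suc m)" by simp
  then have "n < Suc m" by (simp only: strict_mono_less[OF strict_mono_tri])
  then show "n \<le> m" by simp
qed

text \<open>
  In the block that starts at \<open>tri n\<close>, layer \<open>A\<close> has period \<open>n + 1\<close> and layer \<open>B\<close> period \<open>n\<close>. The phase
  \<open>y + 1\<close> of layer \<open>B\<close> puts \<open>At\<close> at its left end exactly when the \<open>At\<close> of layer \<open>A\<close> in the preceding
  block, which also has period \<open>n\<close>, is at its right end. To the left of the origin, there is \<open>After\<close>
  everywhere: the \<open>At\<close> is infinitely far away.
\<close>

definition z_A :: "int \<Rightarrow> int \<Rightarrow> side" where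
  "z_A c y = (if c < 0 then After else mark (c - tri (row c)) (y mod (int (row c) + 1)))"

definition z_B :: "int \<Rightarrow> int \<Rightarrow> side" where
  "z_B c y = (if c < 0 \<or> z_config c = 1 then After
     else mark (c - tri (row c) - 1) ((y + 1) mod int (row c)))"

lemma z_A_tri: "r \<le> n \<Longrightarrow> z_A (tri n + int r) y = mark (int r) (y mod (int n + 1))"
  using tri_nonneg[of n] by (simp add: z_A_def row_tri)

lemma z_B_tri:
  "r \<le> n \<Longrightarrow> z_B (tri n + int r) y = (if r = 0 then After else mark (int r - 1) ((y + 1) mod int n))"
  using tri_nonneg[of n] by (simp add: z_B_def row_tri z_config_between)

lemma mod_succ_eq_iff:
  fixes r p y :: int
  assumes "0 \<le> r" "r + 1 < p"
  shows "r + 1 = (y + 1) mod p \<longleftrightarrow> r = y mod p"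
proof
  assume "r = y mod p"
  then have "(y + 1) mod p = (r + 1) mod p" by (simp add: mod_add_left_eq)
  then show "r + 1 = (y + 1) mod p" using assms by simp
next
  assume "r + 1 = (y + 1) mod p"
  then have "(y + 1 - 1) mod p = (r + 1 - 1) mod p" by (metis mod_diff_left_eq)
  then show "r = y mod p" using assms by simp
qed

lemma succ_mod_eq_0_iff:
  fixes p y :: int
  assumes "0 < p"
  shows "(y + 1) mod p = 0 \<longleftrightarrow> y mod p = p - 1"
proof
  assume "(y + 1) mod p = 0"
  then have "(y + 1 - 1) mod p = (0 - 1) mod p" by (metis mod_diff_left_eq)
  then show "y mod p = p - 1" using assms by (simp add: zmod_minus1)
next
  assume "y mod p = p - 1"
  then have "(y + 1) mod p = (p - 1 + 1) mod p" by (metis mod_add_left_eq)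
  then show "(y + 1) mod p = 0" by simp
qed

lemma step_mark: "step (mark k r) (mark (k + 1) r)"
  by (simp add: mark_def)

lemma mark_eq_At: "mark k r = At \<longleftrightarrow> k = r"
  by (simp add: mark_def)

lemma mark_0_mod:
  assumes "0 < p"
  shows "mark 0 (y mod p) \<noteq> After"
proof (cases "y mod p = 0")
  case False
  then have "0 < y mod p" using pos_mod_sign[OF assms, of y] by linarith
  then show ?thesis by (simp add: mark_def)
qed (simp add: mark_def)

lemma mark_last_mod:
  assumes "0 < p"
  shows "mark (p - 1) (y mod p) \<noteq> Before"
proof -
  have "\<not> p - 1 < y mod p" using pos_mod_bound[OF assms, of y] by linarith
  then show ?thesis unfolding mark_def by (simp only: if_False) simp
qed

lemma marked_z: "marked z_config z_A z_B"
  unfolding marked_def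
proof
  fix c
  consider "c < -1" | "c = -1" | n r where "c = tri n + int r" "r < n" | n where "c = tri n + int n"
  proof (cases "c < 0")
    case False
    then obtain n r where "c = tri n + int r" "r \<le> n" using tri_decompose[of c] by auto
    then show thesis using that by (cases "r = n") auto
  qed linarith
  then show "(z_config (c + 1) = 0 \<longrightarrow> glued z_A c) \<and>
     (z_config (c + 1) = 1 \<longrightarrow> (\<forall>y. z_A c y \<noteq> Before \<and> z_A (c + 1) y \<noteq> After \<and> (z_A c y = At \<longleftrightarrow> z_B (c + 2) y = At))) \<and>
     (z_config c = 0 \<longrightarrow> z_config (c + 1) = 0 \<longrightarrow> glued z_B c) \<and>
     (z_config c = 1 \<longrightarrow> (\<forall>y. z_B c y \<noteq> At)) \<and>
     (z_config c = 1 \<longrightarrow> z_config (c + 1) = 0 \<longrightarrow> (\<forall>y. z_B (c + 1) y \<noteq> After)) \<and>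
     (z_config c = 0 \<longrightarrow> z_config (c + 1) = 1 \<longrightarrow> (\<forall>y. z_B c y \<noteq> Before))" (is ?P)
  proof cases
    case 1
    then show ?P by (simp add: z_config_neg glued_def z_A_def z_B_def)
  next
    case 2
    have "z_config 0 = 1" "z_config 1 = 1"
      using z_config_between[of 0 0] z_config_between[of 0 1] by (simp_all add: tri_Suc)
    moreover have "z_A 0 y \<noteq> After" for y using z_A_tri[of 0 0 y] by (simp add: mark_def)
    ultimately show ?P using 2 by (simp add: z_config_neg z_A_def[of "-1"] z_B_def)
  next
    case (3 n r)
    have c1: "c + 1 = tri n + int (Suc r)" using 3 by simp
    have C: "z_config (c + 1) = 0" "z_config c = (if r = 0 then 1 else 0)"
      unfolding c1 unfolding 3(1) using 3(2) by (simp_all only: z_config_between) auto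
    have A: "z_A c y = mark (int r) (y mod (int n + 1))"
      "z_A (c + 1) y = mark (int r + 1) (y mod (int n + 1))" for y
      unfolding c1 unfolding 3(1) using 3(2) by (simp_all add: z_A_tri del: of_nat_Suc) (simp add: add.commute)
    have B: "z_B c y = (if r = 0 then After else mark (int r - 1) ((y + 1) mod int n))"
      "z_B (c + 1) y = mark (int r) ((y + 1) mod int n)" for y
      unfolding c1 unfolding 3(1) using 3(2) by (simp_all add: z_B_tri del: of_nat_Suc) simp
    have "glued z_A c"
      unfolding glued_def A using step_mark mod_succ_eq_iff[of "int r" "int n + 1"] 3(2)
      by (simp add: mark_eq_At)
    moreover have "glued z_B c" if "r \<noteq> 0"
    proof -
      have "int r - 1 = (y + 1) mod int n \<longleftrightarrow> int r = (y + 1 + 1) mod int n" for y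
        using mod_succ_eq_iff[of "int r - 1" "int n" "y + 1"] 3(2) that by auto
      then show ?thesis
        unfolding glued_def B using step_mark[of "int r - 1"] that by (simp add: mark_eq_At)
    qed
    moreover have "z_B (c + 1) y \<noteq> After" if "r = 0" for y
      using that 3(2) mark_0_mod[of "int n" "y + 1"] by (simp add: B)
    ultimately show ?P using C B(1) by simp
  next
    case (4 n)
    have c1: "c + 1 = tri (Suc n) + int 0" "c + 2 = tri (Suc n) + int 1" using 4 by (simp_all add: tri_Suc)
    have C: "z_config (c + 1) = 1" "z_config c = (if n = 0 then 1 else 0)"
      unfolding c1 unfolding 4 by (simp_all only: z_config_between) auto
    have A: "z_A c y = mark (int n) (y mod (int n + 1))"
      "z_A (c + 1) y = mark 0 (y mod (int n + 2))" for y
      unfolding c1 unfolding 4 by (simp_all add: z_A_tri del: of_nat_0) (simp add: add.commute)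
    have B: "z_B (c + 2) y = mark 0 ((y + 1) mod (int n + 1))"
      "z_B c y = (if n = 0 then After else mark (int n - 1) ((y + 1) mod int n))" for y
      using z_B_tri[of 1 "Suc n" y] z_B_tri[of n n y] unfolding c1 unfolding 4 by (simp_all add: add_ac)
    have "z_A c y \<noteq> Before" for y
      unfolding A using mark_last_mod[of "int n + 1" y] by simp
    moreover have "z_A (c + 1) y \<noteq> After" for y
      unfolding A by (rule mark_0_mod) simp
    moreover have "z_A c y = At \<longleftrightarrow> z_B (c + 2) y = At" for y
      unfolding A B mark_eq_At using succ_mod_eq_0_iff[of "int n + 1" y] by auto
    moreover have "z_B c y \<noteq> Before" if "n \<noteq> 0" for y
      unfolding B using mark_last_mod[of "int n" "y + 1"] that by simp
    ultimately show ?P using C B(2) by simp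
  qed
qed

section \<open>The sofic cover\<close>

type_synonym cell = "nat \<times> side \<times> side"

abbreviation color :: "cell \<Rightarrow> nat" where "color \<equiv> fst"
abbreviation layerA :: "cell \<Rightarrow> side" where "layerA s \<equiv> fst (snd s)"
abbreviation layerB :: "cell \<Rightarrow> side" where "layerB s \<equiv> snd (snd s)"

definition cells :: "cell set" where
  "cells = {0, 1} \<times> UNIV \<times> UNIV"

lemma finite_cells: "finite cells"
proof -
  have "(UNIV :: side set) = {Before, At, After}" using side.exhaust by auto
  then have "finite (UNIV :: side set)" by (metis finite.simps)
  then show ?thesis unfolding cells_def by (intro finite_cartesian_product) auto
qed

text \<open>
  The conditions of \<open>marked\<close> at the origin of the plane spanned by \<open>e\<^sub>i\<close> and \<open>e\<^sub>j\<close>. The layers are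
  unconstrained in the remaining directions; only the color has to be constant there.
\<close>

definition local_rule :: "'d::finite \<Rightarrow> 'd \<Rightarrow> (int ^ 'd \<Rightarrow> cell) \<Rightarrow> bool" where
  "local_rule i j x \<longleftrightarrow> (let p = x 0; q = x (axis i 1); q' = x (axis i 1 + axis j 1); r = x (axis i 2) in
     (\<forall>k. k \<noteq> i \<longrightarrow> color (x (axis k 1)) = color p) \<and>
     (color q = 0 \<longrightarrow> step (layerA p) (layerA q) \<and> (layerA p = At \<longleftrightarrow> layerA q' = At)) \<and>
     (color q = 1 \<longrightarrow> layerA p \<noteq> Before \<and> layerA q \<noteq> After \<and> (layerA p = At \<longleftrightarrow> layerB r = At)) \<and>
     (color p = 0 \<longrightarrow> color q = 0 \<longrightarrow> step (layerB p) (layerB q) \<and> (layerB p = At \<longleftrightarrow> layerB q' = At)) \<and>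
     (color p = 1 \<longrightarrow> layerB p \<noteq> At) \<and>
     (color p = 1 \<longrightarrow> color q = 0 \<longrightarrow> layerB q \<noteq> After) \<and>
     (color p = 0 \<longrightarrow> color q = 1 \<longrightarrow> layerB p \<noteq> Before))"

definition cover :: "'d::finite \<Rightarrow> 'd \<Rightarrow> (int ^ 'd \<Rightarrow> cell) set" where
  "cover i j = {x. range x \<subseteq> cells \<and> (\<forall>v. local_rule i j (shift v x))}"

lemma is_sft_cover:
  fixes i j :: "'d::finite"
  shows "is_sft cells (cover i j)"
  unfolding cover_def
proof (rule is_sft_local[OF finite_cells])
  let ?W = "{0, axis i 1, axis i 1 + axis j 1, axis i 2} \<union> range (\<lambda>k. axis k 1) :: (int ^ 'd) set"
  show "finite ?W" by simp
  show "local_rule i j x \<longleftrightarrow> local_rule i j y" if "agree_on ?W x y" for x y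
  proof -
    have "x 0 = y 0" "x (axis i 1 + axis j 1) = y (axis i 1 + axis j 1)" "x (axis i 2) = y (axis i 2)"
      "\<And>k. x (axis k 1) = y (axis k 1)"
      using that by (auto simp: agree_on_def)
    then show ?thesis unfolding local_rule_def by simp
  qed
qed

lemma local_rule_imp_marked:
  fixes x :: "int ^ 'd::finite \<Rightarrow> cell"
  assumes C: "\<And>c y. color (x (axis i c + axis j y)) = C c" and "i \<noteq> j"
    and rules: "\<And>v. local_rule i j (shift v x)"
  shows "marked C (\<lambda>c y. layerA (x (axis i c + axis j y))) (\<lambda>c y. layerB (x (axis i c + axis j y)))"
proof -
  define X where "X c y = x (axis i c + axis j y)" for c y
  have e: "axis i c + axis j y + axis i 1 = axis i (c + 1) + axis j y"
    "axis i c + axis j y + axis i 2 = axis i (c + 2) + axis j y"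
    "axis i c + axis j y + (axis i 1 + axis j 1) = axis i (c + 1) + axis j (y + 1)" for c y :: int
    by (simp_all add: axis_add algebra_simps)
  have "(C (c + 1) = 0 \<longrightarrow> step (layerA (X c y)) (layerA (X (c + 1) y)) \<and>
        (layerA (X c y) = At \<longleftrightarrow> layerA (X (c + 1) (y + 1)) = At)) \<and>
     (C (c + 1) = 1 \<longrightarrow> layerA (X c y) \<noteq> Before \<and> layerA (X (c + 1) y) \<noteq> After \<and>
        (layerA (X c y) = At \<longleftrightarrow> layerB (X (c + 2) y) = At)) \<and>
     (C c = 0 \<longrightarrow> C (c + 1) = 0 \<longrightarrow> step (layerB (X c y)) (layerB (X (c + 1) y)) \<and>
        (layerB (X c y) = At \<longleftrightarrow> layerB (X (c + 1) (y + 1)) = At)) \<and>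
     (C c = 1 \<longrightarrow> layerB (X c y) \<noteq> At) \<and>
     (C c = 1 \<longrightarrow> C (c + 1) = 0 \<longrightarrow> layerB (X (c + 1) y) \<noteq> After) \<and>
     (C c = 0 \<longrightarrow> C (c + 1) = 1 \<longrightarrow> layerB (X c y) \<noteq> Before)" for c y
    using rules[of "axis i c + axis j y", unfolded local_rule_def Let_def shift_def add_0_right e C] by (simp add: X_def)
  then show ?thesis unfolding marked_def glued_def X_def[symmetric] by blast
qed

lemma constant_off_axis:
  fixes f :: "int ^ 'd::finite \<Rightarrow> 'a"
  assumes "\<And>v k. k \<noteq> i \<Longrightarrow> f (v + axis k 1) = f v"
  shows "f v = f (axis i (v $ i))"
proof -
  have nat: "f (v + axis k (int n)) = f v" if "k \<noteq> i" for v k n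
  proof (induction n)
    case 0
    have "axis k (int 0) = (0 :: int ^ 'd)" by (simp add: vec_eq_iff axis_def)
    then show ?case by (simp only: add_0_right)
  next
    case (Suc n)
    have "v + axis k (int (Suc n)) = v + axis k (int n) + axis k 1"
      by (simp add: axis_add add_ac)
    then show ?case by (simp only: assms[OF that] Suc)
  qed
  have int: "f (v + axis k m) = f v" if "k \<noteq> i" for v k m
  proof (cases "0 \<le> m")
    case True
    then show ?thesis using nat[OF that, of v "nat m"] by simp
  next
    case False
    then have "int (nat (- m)) = - m" by simp
    moreover have "v + axis k m + axis k (- m) = v" by (simp add: vec_eq_iff axis_def)
    ultimately show ?thesis using nat[OF that, of "v + axis k m" "nat (- m)"] by metis
  qed
  have "f (\<chi> l. if l \<in> K then 0 else v $ l) = f v" if "finite K" "i \<notin> K" for K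
    using that
  proof (induction rule: finite_induct)
    case (insert k K)
    have eq: "(\<chi> l. if l \<in> insert k K then 0 else v $ l) = (\<chi> l. if l \<in> K then 0 else v $ l) + axis k (- (v $ k))"
      using insert.hyps by (auto simp: vec_eq_iff axis_def)
    have "k \<noteq> i" "i \<notin> K" using insert.prems by auto
    then show ?case by (simp only: eq int[OF \<open>k \<noteq> i\<close>] insert.IH[OF \<open>i \<notin> K\<close>])
  qed simp
  from this[of "- {i}"] have "f (\<chi> l. if l \<in> - {i} then 0 else v $ l) = f v" by simp
  moreover have "(\<chi> l. if l \<in> - {i} then 0 else v $ l) = axis i (v $ i)"
    by (auto simp: vec_eq_iff axis_def)
  ultimately show ?thesis by simp
qed

lemma cover_projects_into_P_dag:
  assumes x: "x \<in> cover i j" and "i \<noteq> j"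
  shows "color \<circ> x \<in> P_dag i Z_shift"
proof -
  define C where "C c = color (x (axis i c))" for c
  have rules: "local_rule i j (shift v x)" for v using x by (simp add: cover_def)
  have "color (x (v + axis k 1)) = color (x v)" if "k \<noteq> i" for v k
    using rules[of v] that by (simp add: local_rule_def Let_def shift_def)
  then have col: "color (x v) = C (v $ i)" for v
    unfolding C_def by (rule constant_off_axis[where f = "\<lambda>v. color (x v)"])
  have "range C \<subseteq> {0, 1}"
  proof -
    have "x v \<in> cells" for v using x by (auto simp: cover_def)
    then have "color (x v) \<in> {0, 1}" for v unfolding cells_def by (metis mem_Times_iff)
    then show ?thesis unfolding C_def by (intro image_subsetI)
  qed
  moreover have "marked C (\<lambda>c y. layerA (x (axis i c + axis j y))) (\<lambda>c y. layerB (x (axis i c + axis j y)))"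
    using rules \<open>i \<noteq> j\<close> by (intro local_rule_imp_marked) (simp_all add: col axis_nth_if)
  ultimately have "C \<in> Z_shift" by (rule marked_imp_Z_shift)
  then show ?thesis unfolding P_dag_def using col by (auto simp: o_def)
qed

definition z_cover :: "'d::finite \<Rightarrow> 'd \<Rightarrow> int ^ 'd \<Rightarrow> cell" where
  "z_cover i j v = (z_config (v $ i), z_A (v $ i) (v $ j), z_B (v $ i) (v $ j))"

lemma z_cover_in_cover:
  fixes i j :: "'d::finite"
  assumes "i \<noteq> j"
  shows "z_cover i j \<in> cover i j"
  unfolding cover_def
proof (intro CollectI conjI allI)
  show "range (z_cover i j) \<subseteq> cells" by (intro image_subsetI) (simp add: z_cover_def cells_def z_config_tri)
  fix v :: "int ^ 'd"
  show "local_rule i j (shift v (z_cover i j))"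
    using marked_z[unfolded marked_def glued_def, rule_format, of "v $ i"] assms
    by (simp add: local_rule_def Let_def shift_def z_cover_def axis_nth_if)
qed

text \<open>
  It is enough to find a preimage of the lift of \<open>z\<close>: the image of the cover is closed and
  shift-invariant, so it contains the lifts of all limits of shifts of \<open>z\<close> as well.
\<close>

lemma lift_orbit_closure_subset:
  fixes i :: "'d::finite"
  assumes X: "shift_space A X" and z: "lift i y \<in> X"
  shows "P_dag i (orbit_closure A y) \<subseteq> X"
proof
  fix x assume "x \<in> P_dag i (orbit_closure A y)"
  then obtain y' where y': "y' \<in> orbit_closure A y" "x = lift i y'"
    unfolding P_dag_eq_lift by (elim imageE)
  have "x \<in> orbit_closure A (lift i y)"
    unfolding orbit_closure_def in_closure_of_config_iff
  proof (intro conjI allI impI)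
    show "range x \<subseteq> A" 
      using y' unfolding orbit_closure_def in_closure_of_config_iff by (auto simp: lift_def)
    fix W :: "(int ^ 'd) set" assume "finite W"
    then have "finite ((\<lambda>w. w $ i) ` W)" by simp
    then obtain v where v: "range (shift v y) \<subseteq> A" "agree_on ((\<lambda>w. w $ i) ` W) y' (shift v y)"
      using y'(1) unfolding orbit_closure_def in_closure_of_config_iff by auto
    have "lift i (shift v y) \<in> range (\<lambda>v. shift v (lift i y))"
      by (rule range_eqI[of _ _ "axis i v"]) (simp add: shift_lift)
    moreover have "range (lift i (shift v y)) \<subseteq> A" using v(1) by (auto simp: lift_def)
    moreover have "agree_on W x (lift i (shift v y))" using v(2) y'(2) by (simp add: agree_on_def lift_def)
    ultimately show "\<exists>u\<in>range (\<lambda>v. shift v (lift i y)). range u \<subseteq> A \<and> agree_on W x u"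
      by (intro bexI[of _ "lift i (shift v y)"]) simp_all
  qed
  then show "x \<in> X" using orbit_closure_minimal[OF X z] by (rule subsetD[rotated])
qed

lemma shift_space_letter_image:
  fixes S :: "('g::ab_group_add \<Rightarrow> 'a) set"
  assumes S: "shift_space A S" and f: "f ` A \<subseteq> B" "finite B"
  shows "shift_space B ((\<lambda>x. f \<circ> x) ` S)"
  unfolding shift_space_def
proof (intro conjI allI ballI)
  have "compactin (config_topology A) S"
    using S by (auto simp: shift_space_def intro: closedin_compact_space compact_space_config)
  then show "closedin (config_topology B) ((\<lambda>x. f \<circ> x) ` S)"
    by (intro compactin_imp_closedin Hausdorff_space_config image_compactin[OF _ continuous_map_letter[OF f(1)]])
  fix v y assume "y \<in> (\<lambda>x. f \<circ> x) ` S"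
  then obtain x where "x \<in> S" "y = f \<circ> x" by (elim imageE)
  then have "shift v x \<in> S" "shift v y = f \<circ> shift v x"
    using S by (auto simp: shift_space_def shift_def)
  then show "shift v y \<in> (\<lambda>x. f \<circ> x) ` S" by (metis image_eqI)
qed (rule f(2))

lemma sofic_P_dag:
  fixes i j :: "'d::finite"
  assumes "i \<noteq> j"
  shows "sofic \<Gamma> (P_dag i Z_shift)"
proof -
  let ?\<phi> = "\<lambda>x :: int ^ 'd \<Rightarrow> cell. color \<circ> x"
  have ss: "shift_space cells (cover i j)" using is_sft_cover[of i j] by (simp add: is_sft_def)
  have letters: "color ` cells \<subseteq> \<Gamma>" by (auto simp: cells_def \<Gamma>_def)
  have im_ss: "shift_space \<Gamma> (?\<phi> ` cover i j)"
    by (rule shift_space_letter_image[OF ss letters]) (simp add: \<Gamma>_def)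
  have im: "?\<phi> ` cover i j = P_dag i Z_shift"
  proof
    show "?\<phi> ` cover i j \<subseteq> P_dag i Z_shift"
      using assms by (intro image_subsetI cover_projects_into_P_dag)
    have "lift i z_config = ?\<phi> (z_cover i j)" by (simp add: lift_def z_cover_def fun_eq_iff)
    then have "lift i z_config \<in> ?\<phi> ` cover i j" using z_cover_in_cover[OF assms] by (rule image_eqI)
    then show "P_dag i Z_shift \<subseteq> ?\<phi> ` cover i j"
      unfolding Z_shift_eq_orbit_closure by (rule lift_orbit_closure_subset[OF im_ss])
  qed
  have "continuous_map (subtopology (config_topology cells) (cover i j))
      (subtopology (config_topology \<Gamma>) (P_dag i Z_shift)) ?\<phi>"
    using continuous_map_letter[OF letters] im
    by (auto simp: continuous_map_in_subtopology intro: continuous_map_from_subtopology)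
  then have "sft_cover cells (cover i j) ?\<phi> \<Gamma> (P_dag i Z_shift)"
    using is_sft_cover ss im im_ss
    by (simp add: sft_cover_def block_code_def) (simp add: shift_def o_def)
  then show ?thesis by (rule soficI)
qed

theorem mainTheorem1:
  fixes i :: "'d::finite"
  shows "Z_shift = orbit_closure \<Gamma> z_config \<and>
    (CARD('d) \<ge> 2 \<longrightarrow>
       sofic \<Gamma> (P_dag i Z_shift) \<and>
       countable (P_dag i Z_shift) \<and>
       \<not> countably_covered \<Gamma> (P_dag i Z_shift)) \<and>
    (CARD('d) \<ge> 2 \<longrightarrow>
       (\<exists>(B :: nat set) (X :: (int ^ 'd \<Rightarrow> nat) set).
          sofic B X \<and> countable X \<and> \<not> countably_covered B X))"
proof -
  have "sofic \<Gamma> (P_dag i Z_shift)" if "CARD('d) \<ge> 2"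
  proof -
    have "(UNIV :: 'd set) \<noteq> {i}" using that by (metis card_1_singleton_iff numeral_le_one_iff One_nat_def semiring_norm(69))
    then obtain j where "j \<noteq> i" by (auto simp: set_eq_iff)
    then show ?thesis by (intro sofic_P_dag[of i j]) simp
  qed
  moreover have "countable (P_dag i Z_shift)"
    unfolding P_dag_eq_lift using countable_Z_shift by (rule countable_image)
  ultimately show ?thesis
    using Z_shift_eq_orbit_closure not_countably_covered_P_dag[of i] by auto
qed

end
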